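(* Let $m \ge 1$ be an integer. If $S_{m,2}$ is the free metabelian group of rank $m$, then $$\mathrm{Conj}_{S_{m,2}}(n) \preceq n^{n^{n^2}}.$$
   Context: The free metabelian group of rank $m$ is $S_{m,2} = F_m / F_m^{(2)}$, where $F_m$ is the free group of rank $m$, $F_m^{(0)} = F_m$ and $F_m^{(i)} = [F_m^{(i-1)},F_m^{(i-1)}]$. A group $G$ is conjugacy separable if for all non-conjugate $g,h\in G$ there is a finite quotient of $G$ in which their images are not conjugate. For a finitely generated conjugacy separable group $G$ with a fixed finite generating set and associated word length $\|\cdot\|$, write $g^G$ for the conjugacy class of $g$, and for $h \notin g^G$ let $\mathrm{D}_G(g^G,h)$ be the minimum of $[G:N]$ over finite-index normal subgroups $N$ of $G$ such that the images of $g$ and $h$ are not conjugate in $G/N$; then $\mathrm{Conj}_G(n) = \max\{\mathrm{D}_G(g^G,h) : h \notin g^G,\ \|g\|,\|h\| \le n\}$. For nondecreasing $f,g\colon \mathbb{N}\to\mathbb{N}$, $f \preceq g$ means there is a constant $K \in \mathbb{N}$ with $f(n) \le K g(Kn)$ for all $n\in\mathbb{N}$. The $\preceq$-class of $\mathrm{Conj}_G$ does not depend on the finite generating set. *)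

theory Defs
  imports "HOL-Algebra.Algebra" "HOL-Library.Extended_Nat"
begin

section \<open>Free groups\<close>

text \<open>A letter \<open>(a, True)\<close> stands for the generator \<open>a\<close> and \<open>(a, False)\<close> for its formal inverse.
  Elements of the free group are the freely reduced words.\<close>

definition flip_letter :: "'a \<times> bool \<Rightarrow> 'a \<times> bool" where
  "flip_letter x = (fst x, \<not> snd x)"

definition reduced :: "('a \<times> bool) list \<Rightarrow> bool" where
  "reduced w \<longleftrightarrow> successively (\<lambda>x y. y \<noteq> flip_letter x) w"

fun push_letter :: "'a \<times> bool \<Rightarrow> ('a \<times> bool) list \<Rightarrow> ('a \<times> bool) list" where
  "push_letter x [] = [x]"
| "push_letter x (y # w) = (if y = flip_letter x then w else x # y # w)"

definition free_group :: "'a set \<Rightarrow> ('a \<times> bool) list monoid" where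
  "free_group A =
    \<lparr>carrier = {w. set w \<subseteq> A \<times> UNIV \<and> reduced w},
     monoid.mult = (\<lambda>u v. foldr push_letter u v),
     one = []\<rparr>"

lemma flip_flip [simp]: "flip_letter (flip_letter x) = x"
  by (simp add: flip_letter_def)

lemma flip_neq [simp]: "flip_letter x \<noteq> x" "x \<noteq> flip_letter x"
  by (auto simp: flip_letter_def prod_eq_iff)

lemma flip_in [simp]: "flip_letter x \<in> A \<times> UNIV \<longleftrightarrow> x \<in> A \<times> UNIV"
  by (auto simp: flip_letter_def mem_Times_iff)

lemma reduced_Nil [simp]: "reduced []"
  by (simp add: reduced_def)

lemma reduced_Cons: "reduced (x # w) \<longleftrightarrow> (w = [] \<or> hd w \<noteq> flip_letter x) \<and> reduced w"
  by (auto simp: reduced_def successively_Cons)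

lemma push_reduced: "reduced w \<Longrightarrow> reduced (push_letter x w)"
  by (cases w) (auto simp: reduced_Cons)

lemma push_eq_Cons: "reduced (x # w) \<Longrightarrow> push_letter x w = x # w"
  by (cases w) (auto simp: reduced_Cons)

lemma push_set: "x \<in> A \<times> UNIV \<Longrightarrow> set w \<subseteq> A \<times> UNIV \<Longrightarrow> set (push_letter x w) \<subseteq> A \<times> UNIV"
  by (cases w) auto

lemma push_flip: "reduced w \<Longrightarrow> push_letter x (push_letter (flip_letter x) w) = w"
  by (cases w) (auto simp: push_eq_Cons)

lemma foldr_push_reduced: "reduced v \<Longrightarrow> reduced (foldr push_letter u v)"
  by (induction u) (auto simp: push_reduced)

lemma foldr_push_set:
  "set u \<subseteq> A \<times> UNIV \<Longrightarrow> set v \<subseteq> A \<times> UNIV \<Longrightarrow> set (foldr push_letter u v) \<subseteq> A \<times> UNIV"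
proof (induction u)
  case (Cons x u)
  then have "x \<in> A \<times> UNIV" "set (foldr push_letter u v) \<subseteq> A \<times> UNIV" by auto
  then show ?case using push_set by (metis comp_apply foldr_Cons)
qed simp

lemma foldr_push_Nil: "reduced u \<Longrightarrow> foldr push_letter u [] = u"
  by (induction u) (auto simp: reduced_Cons push_eq_Cons)

lemma foldr_push_push:
  "reduced u \<Longrightarrow> reduced w \<Longrightarrow>
    foldr push_letter (push_letter x u) w = push_letter x (foldr push_letter u w)"
proof (cases u)
  case (Cons y v)
  assume "reduced u" "reduced w"
  then show ?thesis
    using push_flip[of "foldr push_letter v w" x] foldr_push_reduced[of w v] Cons by auto
qed simp

lemma foldr_push_assoc:
  "reduced u \<Longrightarrow> reduced v \<Longrightarrow> reduced w \<Longrightarrow>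
    foldr push_letter (foldr push_letter u v) w = foldr push_letter u (foldr push_letter v w)"
  by (induction u) (auto simp: foldr_push_push foldr_push_reduced reduced_Cons)

lemma foldr_push_inverse:
  "reduced v \<Longrightarrow> foldr push_letter (rev (map flip_letter w)) (foldr push_letter w v) = v"
proof (induction w arbitrary: v)
  case (Cons x w)
  have "reduced (foldr push_letter w v)" using Cons.prems foldr_push_reduced by blast
  from push_flip[OF this, of "flip_letter x"] Cons show ?case by simp
qed simp

lemma reduced_inverse: "reduced w \<Longrightarrow> reduced (rev (map flip_letter w))"
proof -
  assume "reduced w"
  then have "successively (\<lambda>x y. flip_letter x \<noteq> y) w"
    unfolding reduced_def by (rule successively_mono) auto
  then have "successively (\<lambda>x y. flip_letter x \<noteq> flip_letter (flip_letter y)) w"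
    by simp
  then show ?thesis by (simp only: reduced_def successively_rev successively_map)
qed

lemma group_free_group: "group (free_group A)"
proof (rule groupI)
  fix w assume w: "w \<in> carrier (free_group A)"
  let ?v = "rev (map flip_letter w)"
  have "set ?v \<subseteq> A \<times> UNIV" using w by (auto simp: free_group_def flip_letter_def)
  then have "?v \<in> carrier (free_group A)"
    using w reduced_inverse by (auto simp: free_group_def)
  moreover have "?v \<otimes>\<^bsub>free_group A\<^esub> w = \<one>\<^bsub>free_group A\<^esub>"
    using w foldr_push_inverse[of "[]" w] foldr_push_Nil[of w] by (simp add: free_group_def)
  ultimately show "\<exists>v\<in>carrier (free_group A). v \<otimes>\<^bsub>free_group A\<^esub> w = \<one>\<^bsub>free_group A\<^esub>"
    by blast
qed (auto simp: free_group_def foldr_push_reduced foldr_push_assoc dest: foldr_push_set[THEN subsetD])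

lemma free_group_generated:
  "generate (free_group A) ((\<lambda>a. [(a, True)]) ` A) = carrier (free_group A)"
    (is "generate ?F ?X = _")
proof
  interpret group ?F by (rule group_free_group)
  have S: "?X \<subseteq> carrier ?F" by (auto simp: free_group_def reduced_def)
  then show "generate ?F ?X \<subseteq> carrier ?F" by (rule generate_incl)
  have letter: "[x] \<in> generate ?F ?X" if "x \<in> A \<times> UNIV" for x
  proof (cases "snd x")
    case True
    then show ?thesis using that by (intro generate.incl) (auto simp: prod_eq_iff image_iff)
  next
    case False
    have "[(fst x, True)] \<in> carrier ?F" "[x] \<in> carrier ?F"
      using that by (auto simp: free_group_def reduced_def)
    moreover have "[x] \<otimes>\<^bsub>?F\<^esub> [(fst x, True)] = \<one>\<^bsub>?F\<^esub>"
      using False by (simp add: free_group_def flip_letter_def)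
    ultimately have "inv\<^bsub>?F\<^esub> [(fst x, True)] = [x]" by (simp add: inv_equality)
    then show ?thesis using that by (metis generate.inv imageI mem_Times_iff)
  qed
  have "set w \<subseteq> A \<times> UNIV \<Longrightarrow> reduced w \<Longrightarrow> w \<in> generate ?F ?X" for w
  proof (induction w)
    case Nil
    then show ?case using generate.one[of ?F ?X] by (simp add: free_group_def)
  next
    case (Cons x w)
    then have "[x] \<otimes>\<^bsub>?F\<^esub> w \<in> generate ?F ?X"
      by (intro generate.eng letter) (auto simp: reduced_Cons)
    then show ?case using Cons.prems by (simp add: free_group_def push_eq_Cons)
  qed
  then show "carrier ?F \<subseteq> generate ?F ?X" by (auto simp: free_group_def)
qed

lemma free_group_extend:
  assumes "group H" and f: "f \<in> A \<rightarrow> carrier H"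
  shows "\<exists>\<phi>\<in>hom (free_group A) H. \<forall>a\<in>A. \<phi> [(a, True)] = f a"
proof -
  interpret H: group H by fact
  define l where "l x = (if snd x then f (fst x) else inv\<^bsub>H\<^esub> f (fst x))" for x
  define \<phi> where "\<phi> w = foldr (\<lambda>x y. l x \<otimes>\<^bsub>H\<^esub> y) w \<one>\<^bsub>H\<^esub>" for w
  have l: "l x \<in> carrier H" if "x \<in> A \<times> UNIV" for x
    using that f by (auto simp: l_def)
  have lflip: "l x \<otimes>\<^bsub>H\<^esub> l (flip_letter x) = \<one>\<^bsub>H\<^esub>" if "x \<in> A \<times> UNIV" for x
    using that f by (auto simp: l_def flip_letter_def Pi_iff)
  have Cons: "\<phi> (x # w) = l x \<otimes>\<^bsub>H\<^esub> \<phi> w" for x w by (simp add: \<phi>_def)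
  have Nil: "\<phi> [] = \<one>\<^bsub>H\<^esub>" by (simp add: \<phi>_def)
  have closed: "\<phi> w \<in> carrier H" if "set w \<subseteq> A \<times> UNIV" for w
    using that by (induction w) (auto simp: Cons Nil intro!: H.m_closed l)
  have push: "\<phi> (push_letter x w) = l x \<otimes>\<^bsub>H\<^esub> \<phi> w"
    if x: "x \<in> A \<times> UNIV" and w: "set w \<subseteq> A \<times> UNIV" for x w
  proof (cases "\<exists>v. w = flip_letter x # v")
    case True
    then obtain v where v: "w = flip_letter x # v" by blast
    have fx: "flip_letter x \<in> A \<times> UNIV" using x by simp
    have vc: "\<phi> v \<in> carrier H" using v w closed by simp
    have "l x \<otimes>\<^bsub>H\<^esub> \<phi> w = (l x \<otimes>\<^bsub>H\<^esub> l (flip_letter x)) \<otimes>\<^bsub>H\<^esub> \<phi> v"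
      unfolding v Cons using H.m_assoc[OF l[OF x] l[OF fx] vc] by simp
    then show ?thesis using v vc lflip[OF x] by simp
  next
    case False
    then have "push_letter x w = x # w" by (cases w) auto
    then show ?thesis by (simp add: Cons)
  qed
  have mult: "\<phi> (foldr push_letter u v) = \<phi> u \<otimes>\<^bsub>H\<^esub> \<phi> v"
    if "set u \<subseteq> A \<times> UNIV" and v: "set v \<subseteq> A \<times> UNIV" for u v
    using that(1)
  proof (induction u)
    case Nil
    then show ?case using v closed by (simp add: \<open>\<phi> [] = \<one>\<^bsub>H\<^esub>\<close>)
  next
    case (Cons x u)
    have x: "x \<in> A \<times> UNIV" and u: "set u \<subseteq> A \<times> UNIV" using Cons.prems by auto
    have "\<phi> (push_letter x (foldr push_letter u v)) = l x \<otimes>\<^bsub>H\<^esub> (\<phi> u \<otimes>\<^bsub>H\<^esub> \<phi> v)"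
      using push[OF x foldr_push_set[OF u v]] Cons.IH[OF u] by simp
    then show ?case
      using H.m_assoc[OF l[OF x] closed[OF u] closed[OF v]]
      by (simp add: \<open>\<And>x w. \<phi> (x # w) = l x \<otimes>\<^bsub>H\<^esub> \<phi> w\<close>)
  qed
  have "\<phi> \<in> hom (free_group A) H"
    by (rule homI) (use closed mult in \<open>auto simp: free_group_def\<close>)
  moreover have "\<phi> [(a, True)] = f a" if "a \<in> A" for a
    using that funcset_mem[OF f] by (simp add: Cons Nil l_def)
  ultimately show ?thesis by blast
qed

section \<open>Free metabelian groups\<close>

definition free_metabelian :: "nat \<Rightarrow> (nat \<times> bool) list set monoid" where
  "free_metabelian m =
    free_group {..<m} Mod ((derived (free_group {..<m}) ^^ 2) (carrier (free_group {..<m})))"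

section \<open>Conjugacy separability functions\<close>

definition conj_class :: "('a, 'b) monoid_scheme \<Rightarrow> 'a \<Rightarrow> 'a set" where
  "conj_class G g = {c \<otimes>\<^bsub>G\<^esub> g \<otimes>\<^bsub>G\<^esub> inv\<^bsub>G\<^esub> c | c. c \<in> carrier G}"

text \<open>Only meaningful for \<open>g\<close> in the subgroup generated by \<open>S\<close>.\<close>

definition word_length :: "('a, 'b) monoid_scheme \<Rightarrow> 'a set \<Rightarrow> 'a \<Rightarrow> nat" where
  "word_length G S g = (LEAST n. \<exists>w. length w = n \<and>
     set w \<subseteq> S \<union> m_inv G ` S \<and> g = foldr (\<otimes>\<^bsub>G\<^esub>) w \<one>\<^bsub>G\<^esub>)"

definition separates_conj :: "('a, 'b) monoid_scheme \<Rightarrow> 'a set \<Rightarrow> 'a \<Rightarrow> 'a \<Rightarrow> bool" where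
  "separates_conj G N g h \<longleftrightarrow> N \<lhd> G \<and> finite (rcosets\<^bsub>G\<^esub> N) \<and>
     N #>\<^bsub>G\<^esub> h \<notin> conj_class (G Mod N) (N #>\<^bsub>G\<^esub> g)"

definition conjugacy_separable :: "('a, 'b) monoid_scheme \<Rightarrow> bool" where
  "conjugacy_separable G \<longleftrightarrow>
     (\<forall>g\<in>carrier G. \<forall>h\<in>carrier G. h \<notin> conj_class G g \<longrightarrow> (\<exists>N. separates_conj G N g h))"

text \<open>Values in \<^typ>\<open>enat\<close>: the infimum of the empty set is \<open>\<infinity>\<close>, so a group that is not conjugacy
  separable gets no finite junk value; a nonempty infimum is a minimum.\<close>

definition conj_depth :: "('a, 'b) monoid_scheme \<Rightarrow> 'a \<Rightarrow> 'a \<Rightarrow> enat" where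
  "conj_depth G g h = Inf {enat (card (rcosets\<^bsub>G\<^esub> N)) | N. separates_conj G N g h}"

text \<open>For finite \<open>S\<close> this is the supremum over a finite set, hence a maximum (\<open>0\<close> if the set is
  empty, as it is for \<open>n = 0\<close>).\<close>

definition Conj :: "('a, 'b) monoid_scheme \<Rightarrow> 'a set \<Rightarrow> nat \<Rightarrow> enat" where
  "Conj G S n = Sup {conj_depth G g h | g h. g \<in> carrier G \<and> h \<in> carrier G \<and>
     h \<notin> conj_class G g \<and> word_length G S g \<le> n \<and> word_length G S h \<le> n}"

definition growth_le :: "(nat \<Rightarrow> enat) \<Rightarrow> (nat \<Rightarrow> enat) \<Rightarrow> bool"  (infix \<open>\<preceq>\<close> 50) where
  "f \<preceq> g \<longleftrightarrow> (\<exists>K::nat. \<forall>n. f n \<le> enat K * g (K * n))"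

lemma conjugacy_separable_iff_conj_depth:
  "conjugacy_separable G \<longleftrightarrow>
     (\<forall>g\<in>carrier G. \<forall>h\<in>carrier G. h \<notin> conj_class G g \<longrightarrow> conj_depth G g h < \<infinity>)"
proof -
  have "conj_depth G g h < \<infinity> \<longleftrightarrow> (\<exists>N. separates_conj G N g h)" for g h
    unfolding conj_depth_def by (simp only: Inf_less_iff) auto
  then show ?thesis unfolding conjugacy_separable_def by simp
qed

end

theory Submission
  imports Defs "HOL-Library.Poly_Mapping"
begin

text \<open>
  Let \<open>F\<close> be the free group of rank \<open>m\<close>. A word in the generators is a path in the Cayley graph of
  \<open>\<int>\<^sup>m\<close>, and the integral flow of this path (the net number of traversals of each edge) together with
  its endpoint is exactly what the word still determines in \<open>F/F''\<close>; this is the Magnus embedding of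
  \<open>F/F''\<close> into the wreath product of \<open>\<int>\<^sup>m\<close> with \<open>\<int>\<^sup>m\<close>. Two facts make it usable. A closed path with zero
  flow is trivial modulo \<open>F''\<close> (\<open>flow_zero_cls\<close>): after a choice of return paths it is a product of
  loops, one for each traversed edge, and these lie in \<open>F'\<close> and so commute modulo \<open>F''\<close>. Conversely every
  finitely supported flow without sources and sinks is the flow of a closed path
  (\<open>exists_closed_word\<close>).

  Conjugation by a word with endpoint \<open>b\<close> translates the flow of \<open>g\<close> by \<open>b\<close> and then changes it by
  a difference of a flow and its translate by \<open>a\<close>, the endpoint of \<open>g\<close>. Hence \<open>g\<close> and \<open>h\<close>, both with
  endpoint \<open>a\<close>, are conjugate as soon as their flows, pushed forward to the quotient of \<open>\<int>\<^sup>m\<close> by the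
  multiples of \<open>a\<close>, are translates of each other (\<open>flow_translate_conjugate\<close>).

  This criterion passes to a finite quotient. Replace the multiples of \<open>a\<close> by the finite-index subgroup
  \<open>B = \<int>a + L\<int>\<^sup>m\<close> and the integers by residues modulo \<open>q\<close>. The endpoint modulo \<open>L\<close> and the flow
  modulo \<open>B\<close> and \<open>q\<close> define a finite quotient of \<open>F/F''\<close> of order at most \<open>L\<^sup>m q^(m L\<^sup>m)\<close>. If \<open>g\<close> and
  \<open>h\<close> have length at most \<open>n\<close>, all relevant vectors have coordinates of absolute value at most
  \<open>6n\<close> and all flow values are at most \<open>n\<close>. So it suffices that \<open>q > 2n\<close> and that \<open>B\<close> has no vectors of
  that size besides the multiples of \<open>a\<close>; an \<open>L\<close> of cubic size in \<open>n\<close> achieves this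
  (\<open>thickening_modulus\<close>). The order is then roughly \<open>n^(n^(3 m))\<close>, which is below
  \<open>n^(n^(n^2))\<close> up to constants.
\<close>

section \<open>Words as paths in the Cayley graph of the integer lattice\<close>

text \<open>Finitely supported vectors put all the lattices \<open>\<int>\<^sup>m\<close> into one abelian group; a vector belongs to
  \<open>\<int>\<^sup>m\<close> if its coordinates from \<open>m\<close> on vanish. An edge \<open>(v, i)\<close> of the Cayley graph leads from \<open>v\<close>
  to \<open>v + axis i\<close>.\<close>

type_synonym vec = "nat \<Rightarrow>\<^sub>0 int"

type_synonym signed_edge = "(vec \<times> nat) \<times> bool"

abbreviation coord :: "vec \<Rightarrow> nat \<Rightarrow> int" where
  "coord \<equiv> Poly_Mapping.lookup"

declare lookup_add [simp] lookup_minus [simp]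

definition axis :: "nat \<Rightarrow> vec" where
  "axis i = Poly_Mapping.single i 1"

lemma lookup_axis [simp]: "coord (axis i) j = (if j = i then 1 else 0)"
  by (simp add: axis_def lookup_single when_def)

definition letter_vec :: "nat \<times> bool \<Rightarrow> vec" where
  "letter_vec x = (if snd x then axis (fst x) else - axis (fst x))"

definition endpoint :: "(nat \<times> bool) list \<Rightarrow> vec" where
  "endpoint w = sum_list (map letter_vec w)"

text \<open>An inverse letter runs backwards along the edge that starts where the letter ends.\<close>

definition letter_edge :: "vec \<Rightarrow> nat \<times> bool \<Rightarrow> signed_edge" where
  "letter_edge v x =
    (if snd x then ((v, fst x), True) else ((v - axis (fst x), fst x), False))"

fun steps :: "vec \<Rightarrow> (nat \<times> bool) list \<Rightarrow> signed_edge list" where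
  "steps v [] = []"
| "steps v (x # w) = letter_edge v x # steps (v + letter_vec x) w"

definition edge_count :: "vec set \<Rightarrow> signed_edge \<Rightarrow> vec \<Rightarrow> nat \<Rightarrow> int" where
  "edge_count B x v i =
    (if snd (fst x) = i \<and> v - fst (fst x) \<in> B then (if snd x then 1 else -1) else 0)"

definition netcount :: "vec set \<Rightarrow> signed_edge list \<Rightarrow> vec \<Rightarrow> nat \<Rightarrow> int" where
  "netcount B ls v i = (\<Sum>x\<leftarrow>ls. edge_count B x v i)"

text \<open>For \<open>B = {0}\<close> these are the integer coefficients of the Fox derivatives of \<open>w\<close>, taken in the group
  ring of the lattice. In general it is the flow pushed forward to the quotient by \<open>B\<close>, kept as a
  \<open>B\<close>-periodic function on the lattice, so that all quotients are treated by one function.\<close>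

definition flow :: "vec set \<Rightarrow> (nat \<times> bool) list \<Rightarrow> vec \<Rightarrow> nat \<Rightarrow> int" where
  "flow B w = netcount B (steps 0 w)"

definition vec_subgroup :: "vec set \<Rightarrow> bool" where
  "vec_subgroup B \<longleftrightarrow> 0 \<in> B \<and> (\<forall>x\<in>B. \<forall>y\<in>B. x - y \<in> B)"

definition words :: "nat \<Rightarrow> (nat \<times> bool) list set" where
  "words m = lists ({..<m} \<times> UNIV)"

definition inv_word :: "('a \<times> bool) list \<Rightarrow> ('a \<times> bool) list" where
  "inv_word w = rev (map flip_letter w)"

lemma vec_subgroupD:
  assumes "vec_subgroup B"
  shows "0 \<in> B" "x \<in> B \<Longrightarrow> y \<in> B \<Longrightarrow> x - y \<in> B" "x \<in> B \<Longrightarrow> - x \<in> B"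
    "x \<in> B \<Longrightarrow> y \<in> B \<Longrightarrow> x + y \<in> B"
proof -
  show z: "0 \<in> B" and d: "x \<in> B \<Longrightarrow> y \<in> B \<Longrightarrow> x - y \<in> B" for x y
    using assms by (auto simp: vec_subgroup_def)
  show n: "x \<in> B \<Longrightarrow> - x \<in> B" for x
    using d[OF z, of x] by simp
  show "x \<in> B \<Longrightarrow> y \<in> B \<Longrightarrow> x + y \<in> B"
    using d[of x "- y"] n by simp
qed

lemma vec_subgroup_zero: "vec_subgroup {0}"
  by (simp add: vec_subgroup_def)

lemma vec_subgroup_UNIV: "vec_subgroup UNIV"
  by (simp add: vec_subgroup_def)

lemma letter_vec_flip [simp]: "letter_vec (flip_letter x) = - letter_vec x"
  by (simp add: letter_vec_def flip_letter_def)

lemma endpoint_simps [simp]: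
  "endpoint [] = 0" "endpoint (x # w) = letter_vec x + endpoint w"
  "endpoint (u @ w) = endpoint u + endpoint w"
  by (simp_all add: endpoint_def)

lemma endpoint_inv_word [simp]: "endpoint (inv_word w) = - endpoint w"
  by (induction w) (simp_all add: inv_word_def)

lemma inv_word_simps [simp]:
  "inv_word [] = []" "inv_word (x # w) = inv_word w @ [flip_letter x]"
  by (simp_all add: inv_word_def)

lemma length_inv_word [simp]: "length (inv_word w) = length w"
  by (simp add: inv_word_def)

lemma words_simps [simp]:
  "[] \<in> words m" "x # w \<in> words m \<longleftrightarrow> fst x < m \<and> w \<in> words m"
  "u @ w \<in> words m \<longleftrightarrow> u \<in> words m \<and> w \<in> words m"
  by (auto simp: words_def mem_Times_iff)

lemma inv_word_words [simp]: "w \<in> words m \<Longrightarrow> inv_word w \<in> words m"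
  by (induction w) (simp_all add: flip_letter_def)

lemma netcount_simps [simp]:
  "netcount B [] v i = 0"
  "netcount B (x # ls) v i = edge_count B x v i + netcount B ls v i"
  "netcount B (ls @ ls') v i = netcount B ls v i + netcount B ls' v i"
  by (simp_all add: netcount_def)

lemma edge_count_flip [simp]: "edge_count B (flip_letter x) v i = - edge_count B x v i"
  by (simp add: edge_count_def flip_letter_def)

lemma netcount_flip [simp]: "netcount B (map flip_letter ls) v i = - netcount B ls v i"
  by (induction ls) simp_all

lemma steps_append: "steps v (u @ w) = steps v u @ steps (v + endpoint u) w"
  by (induction u arbitrary: v) (simp_all add: add.assoc)

lemma netcount_steps_shift: "netcount B (steps (t + s) w) v i = netcount B (steps s w) (v - t) i"
proof (induction w arbitrary: s)
  case (Cons x w)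
  have "edge_count B (letter_edge (t + s) x) v i = edge_count B (letter_edge s x) (v - t) i"
    by (auto simp: edge_count_def letter_edge_def algebra_simps)
  then show ?case using Cons.IH[of "s + letter_vec x"] by (simp add: add.assoc)
qed simp

lemma flow_Nil [simp]: "flow B [] v i = 0"
  by (simp add: flow_def)

text \<open>The multiplication rule of the wreath product: the second path is traversed from the endpoint of the
  first one.\<close>

lemma flow_append: "flow B (u @ w) v i = flow B u v i + flow B w (v - endpoint u) i"
  using netcount_steps_shift[of B "endpoint u" 0 w v i] by (simp add: flow_def steps_append)

lemma flow_Cons: "flow B (x # w) v i = flow B [x] v i + flow B w (v - letter_vec x) i"
  using flow_append[of B "[x]" w v i] by simp

lemma flow_singleton: "flow B [x] v i = edge_count B (letter_edge 0 x) v i"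
  by (simp add: flow_def)

lemma flow_flip: "flow B [flip_letter x] v i = - flow B [x] (v + letter_vec x) i"
  by (auto simp: flow_singleton edge_count_def letter_edge_def flip_letter_def letter_vec_def)

lemma flow_inv_word: "flow B (inv_word w) v i = - flow B w (v + endpoint w) i"
proof (induction w arbitrary: v)
  case (Cons x w)
  show ?case
    using Cons.IH[of v] flow_Cons[of B x w "v + letter_vec x + endpoint w" i]
      flow_flip[of B x "v + endpoint w" i]
    by (simp add: flow_append algebra_simps)
qed simp

lemma flow_push_letter: "flow B (push_letter x w) v i = flow B (x # w) v i"
proof (cases w)
  case (Cons y w')
  then show ?thesis
    using flow_append[of B "[x, flip_letter x]" w' v i] flow_Cons[of B x "[flip_letter x]" v i]
    by (auto simp: flow_flip)
qed simp

lemma flow_periodic: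
  assumes "vec_subgroup B" "b \<in> B"
  shows "flow B w (v + b) i = flow B w v i"
proof -
  have "v + b - u \<in> B \<longleftrightarrow> v - u \<in> B" for u
    using vec_subgroupD(2)[OF assms(1), of "v + b - u" b] vec_subgroupD(4)[OF assms(1), of "v - u" b]
      assms(2) by (auto simp: algebra_simps)
  then show ?thesis by (simp add: flow_def netcount_def edge_count_def)
qed

lemma flow_periodic_diff:
  assumes "vec_subgroup B" "v - v' \<in> B"
  shows "flow B w v i = flow B w v' i"
  using flow_periodic[OF assms, of w v' i] by simp

text \<open>If the signed counts of all classes modulo \<open>B\<close> vanish, the first edge must be cancelled by a later one
  of the same class and the opposite sign; removing such a pair keeps all counts zero. This is used with
  \<open>B\<close> everything (abelianization), \<open>B = {0}\<close> (the metabelian quotient) and \<open>B\<close> the multiples of a vector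
  (conjugacy).\<close>

lemma netcount_zero_induct [consumes 3, case_names Nil pair]:
  assumes B: "vec_subgroup B" and E: "set ls \<subseteq> E" and z: "\<And>v i. netcount B ls v i = 0"
    and Nil: "P []"
    and pair: "\<And>x l1 y l2. x \<in> E \<Longrightarrow> y \<in> E \<Longrightarrow> set (l1 @ l2) \<subseteq> E \<Longrightarrow>
       snd (fst x) = snd (fst y) \<Longrightarrow> fst (fst x) - fst (fst y) \<in> B \<Longrightarrow> snd y = (\<not> snd x) \<Longrightarrow>
       P (l1 @ l2) \<Longrightarrow> P (x # l1 @ y # l2)"
  shows "P ls"
  using E z
proof (induction "length ls" arbitrary: ls rule: less_induct)
  case less
  show ?case
  proof (cases ls)
    case Nil
    then show ?thesis using \<open>P []\<close> by simp
  next
    case (Cons x rest)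
    define s :: int where "s = (if snd x then 1 else -1)"
    let ?u = "fst (fst x)" and ?j = "snd (fst x)"
    have ex: "edge_count B x ?u ?j = s"
      using vec_subgroupD(1)[OF B] by (simp add: edge_count_def s_def)
    have "\<exists>y\<in>set rest. edge_count B y ?u ?j = - s"
    proof (rule ccontr)
      assume "\<not> ?thesis"
      then have "0 \<le> s * edge_count B y ?u ?j" if "y \<in> set rest" for y
        using that by (auto simp: edge_count_def s_def split: if_splits)
      then have "0 \<le> (\<Sum>y\<leftarrow>rest. s * edge_count B y ?u ?j)"
        by (intro sum_list_nonneg) auto
      also have "\<dots> = s * netcount B rest ?u ?j"
        by (simp add: netcount_def sum_list_const_mult)
      finally have "0 \<le> s * netcount B rest ?u ?j" .
      moreover have "netcount B rest ?u ?j = - s"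
        using less.prems(2)[of ?u ?j] Cons ex by simp
      ultimately show False by (auto simp: s_def split: if_splits)
    qed
    then obtain y where y: "y \<in> set rest" "edge_count B y ?u ?j = - s" by blast
    then obtain l1 l2 where rest: "rest = l1 @ y # l2" by (meson split_list)
    have same: "?j = snd (fst y)" "?u - fst (fst y) \<in> B" "snd y = (\<not> snd x)"
      using y(2) by (auto simp: edge_count_def s_def split: if_splits)
    have "v - ?u \<in> B \<longleftrightarrow> v - fst (fst y) \<in> B" for v
      using vec_subgroupD(4)[OF B _ same(2), of "v - ?u"]
        vec_subgroupD(2)[OF B _ same(2), of "v - fst (fst y)"]
      by (auto simp: algebra_simps)
    then have "edge_count B x v i + edge_count B y v i = 0" for v i
      using same(1,3) by (auto simp: edge_count_def)
    then have "netcount B (l1 @ l2) v i = 0" for v i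
      using less.prems(2)[of v i] unfolding Cons rest
      by (simp add: add.assoc) (metis add.left_commute add.right_neutral)
    then have "P (l1 @ l2)"
      using less.prems(1) by (intro less.hyps) (auto simp: Cons rest)
    then show ?thesis
      unfolding Cons rest using less.prems(1) same
      by (intro pair) (auto simp: Cons rest)
  qed
qed

lemma steps_edges:
  assumes "w \<in> words m" "\<And>i. m \<le> i \<Longrightarrow> coord v i = 0"
    and "((u, j), s) \<in> set (steps v w)"
  shows "j < m" "\<And>i. m \<le> i \<Longrightarrow> coord u i = 0"
proof -
  have "j < m \<and> (\<forall>i\<ge>m. coord u i = 0)"
    using assms
  proof (induction w arbitrary: v)
    case (Cons x w)
    show ?case
    proof (cases "((u, j), s) = letter_edge v x")
      case True
      then show ?thesis using Cons.prems by (auto simp: letter_edge_def split: if_splits)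
    next
      case False
      then show ?thesis
        using Cons.prems by (intro Cons.IH[of "v + letter_vec x"]) (auto simp: letter_vec_def)
    qed
  qed simp
  then show "j < m" "\<And>i. m \<le> i \<Longrightarrow> coord u i = 0" by auto
qed

lemma steps_near:
  "((u, j), s) \<in> set (steps v w) \<Longrightarrow> \<bar>coord u i - coord v i\<bar> \<le> int (length w)"
proof (induction w arbitrary: v)
  case (Cons x w)
  show ?case
  proof (cases "((u, j), s) = letter_edge v x")
    case True
    then show ?thesis by (auto simp: letter_edge_def split: if_splits)
  next
    case False
    then have "\<bar>coord u i - coord (v + letter_vec x) i\<bar> \<le> int (length w)"
      using Cons.prems by (intro Cons.IH) auto
    moreover have "\<bar>coord (letter_vec x) i\<bar> \<le> 1" by (simp add: letter_vec_def)
    ultimately show ?thesis by (simp add: abs_if split: if_splits)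
  qed
qed simp

lemma length_steps [simp]: "length (steps v w) = length w"
  by (induction w arbitrary: v) simp_all

lemma endpoint_bound: "\<bar>coord (endpoint w) i\<bar> \<le> int (length w)"
proof (induction w)
  case (Cons x w)
  have "\<bar>coord (letter_vec x) i\<bar> \<le> 1" by (simp add: letter_vec_def)
  then show ?case using Cons.IH by (simp add: abs_if split: if_splits)
qed simp

lemma endpoint_support: "w \<in> words m \<Longrightarrow> m \<le> i \<Longrightarrow> coord (endpoint w) i = 0"
  by (induction w) (auto simp: letter_vec_def)

lemma netcount_bound: "\<bar>netcount B ls v i\<bar> \<le> int (length ls)"
proof (induction ls)
  case (Cons x ls)
  have "\<bar>edge_count B x v i\<bar> \<le> 1" by (simp add: edge_count_def)
  then show ?case using Cons.IH by simp
qed simp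

lemma flow_bound: "\<bar>flow B w v i\<bar> \<le> int (length w)"
  using netcount_bound[of B "steps 0 w" v i] by (simp add: flow_def)

lemma netcount_nonzeroE:
  assumes "netcount B ls v i \<noteq> 0"
  obtains u s where "((u, i), s) \<in> set ls" "v - u \<in> B"
proof -
  have "\<exists>x\<in>set ls. edge_count B x v i \<noteq> 0"
    using assms by (induction ls) (auto split: if_splits)
  then obtain x where "x \<in> set ls" "snd (fst x) = i" "v - fst (fst x) \<in> B"
    by (auto simp: edge_count_def split: if_splits)
  then show ?thesis using that[of "fst (fst x)" "snd x"] by (cases x) auto
qed

text \<open>Modulo the whole lattice only the direction of an edge is left, so that the flow is the exponent sum.\<close>

lemma netcount_UNIV_steps:
  "netcount UNIV (steps v w) u i = coord (endpoint w) i"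
  by (induction w arbitrary: v)
    (auto simp: edge_count_def letter_edge_def letter_vec_def)

lemma flow_outside: "w \<in> words m \<Longrightarrow> m \<le> i \<Longrightarrow> flow B w v i = 0"
  unfolding flow_def
  by (rule ccontr, erule netcount_nonzeroE) (use steps_edges(1)[of w m 0] in fastforce)

text \<open>A path has one source, its start, and one sink, its endpoint.\<close>

lemma flow_boundary:
  assumes "w \<in> words m"
  shows "(\<Sum>i<m. flow {0} w (x - axis i) i - flow {0} w x i) =
    (if x = endpoint w then 1 else 0) - (if x = 0 then 1 else 0)"
  using assms
proof (induction w arbitrary: x)
  case (Cons y w)
  obtain j s where y: "y = (j, s)" by (cases y)
  then have j: "j < m" using Cons.prems by simp
  have one: "(\<Sum>i<m. flow {0} [y] (x - axis i) i - flow {0} [y] x i) =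
      (if x = letter_vec y then 1 else 0) - (if x = 0 then 1 else 0)"
  proof -
    have "flow {0} [y] (x - axis i) i - flow {0} [y] x i =
        (if i = j then (if x = letter_vec y then 1 else 0) - (if x = 0 then 1 else 0) else 0)" for i
      by (auto simp: y flow_singleton edge_count_def letter_edge_def letter_vec_def
          algebra_simps eq_neg_iff_add_eq_0)
    then show ?thesis using j by simp
  qed
  have "(\<Sum>i<m. flow {0} (y # w) (x - axis i) i - flow {0} (y # w) x i) =
     (\<Sum>i<m. flow {0} [y] (x - axis i) i - flow {0} [y] x i) +
     (\<Sum>i<m. flow {0} w (x - letter_vec y - axis i) i - flow {0} w (x - letter_vec y) i)"
    by (subst (1 2) flow_Cons) (simp add: sum.distrib sum_subtractf algebra_simps)
  then show ?case
    using one Cons.IH[of "x - letter_vec y"] Cons.prems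
    by (auto simp: algebra_simps)
qed simp

lemma exists_word_endpoint:
  assumes "\<And>i. m \<le> i \<Longrightarrow> coord v i = 0"
  shows "\<exists>w\<in>words m. endpoint w = v"
proof -
  have power: "\<exists>w\<in>words m. \<forall>j. coord (endpoint w) j = k * coord (axis i) j" if "i < m" for i k
  proof (induction k rule: int_induct[where k = 0])
    case base
    then show ?case by (intro bexI[of _ "[]"]) auto
  next
    case (step1 k)
    then obtain w where "w \<in> words m" "\<forall>j. coord (endpoint w) j = k * coord (axis i) j" by blast
    then show ?case using that
      by (intro bexI[of _ "(i, True) # w"]) (auto simp: letter_vec_def algebra_simps)
  next
    case (step2 k)
    then obtain w where "w \<in> words m" "\<forall>j. coord (endpoint w) j = k * coord (axis i) j" by blast
    then show ?case using that
      by (intro bexI[of _ "(i, False) # w"]) (auto simp: letter_vec_def algebra_simps)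
  qed
  have "\<exists>w\<in>words m. \<forall>j. coord (endpoint w) j = (if j < r then coord v j else 0)" if "r \<le> m" for r
    using that
  proof (induction r)
    case 0
    then show ?case by (intro bexI[of _ "[]"]) auto
  next
    case (Suc r)
    then obtain w where w: "w \<in> words m" "\<forall>j. coord (endpoint w) j = (if j < r then coord v j else 0)" by auto
    obtain u where u: "u \<in> words m" "\<forall>j. coord (endpoint u) j = coord v r * coord (axis r) j"
      using power[of r "coord v r"] Suc.prems by auto
    show ?case
      using w u by (intro bexI[of _ "w @ u"]) (auto simp: less_Suc_eq)
  qed
  from this[of m] obtain w where "w \<in> words m" "\<forall>j. coord (endpoint w) j = (if j < m then coord v j else 0)"
    by auto
  then show ?thesis using assms by (intro bexI[of _ w]) (auto intro!: poly_mapping_eqI)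
qed

section \<open>Elements of the free metabelian group as flows\<close>

definition reduce :: "('a \<times> bool) list \<Rightarrow> ('a \<times> bool) list" where
  "reduce w = foldr push_letter w []"

text \<open>The element of \<open>F/F''\<close> represented by a word, which need not be reduced.\<close>

definition cls :: "nat \<Rightarrow> (nat \<times> bool) list \<Rightarrow> (nat \<times> bool) list set" where
  "cls m w = ((derived (free_group {..<m}) ^^ 2) (carrier (free_group {..<m})))
     #>\<^bsub>free_group {..<m}\<^esub> reduce w"

lemma carrier_free_group_iff: "w \<in> carrier (free_group {..<m}) \<longleftrightarrow> w \<in> words m \<and> reduced w"
  by (auto simp: free_group_def words_def lists_eq_set)

lemma reduce_carrier [simp]: "w \<in> words m \<Longrightarrow> reduce w \<in> carrier (free_group {..<m})"
  using foldr_push_set[of w "{..<m}" "[]"] foldr_push_reduced[of "[]" w]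
  by (auto simp: free_group_def words_def lists_eq_set reduce_def)

lemma reduce_words [simp]: "w \<in> words m \<Longrightarrow> reduce w \<in> words m"
  using reduce_carrier carrier_free_group_iff by blast

lemma reduce_id: "w \<in> carrier (free_group {..<m}) \<Longrightarrow> reduce w = w"
  by (simp add: free_group_def reduce_def foldr_push_Nil)

lemma reduce_append: "reduce (u @ w) = reduce u \<otimes>\<^bsub>free_group {..<m}\<^esub> reduce w"
proof (induction u)
  case Nil
  then show ?case by (simp add: free_group_def reduce_def)
next
  case (Cons x u)
  have "reduced (reduce u)" "reduced (reduce w)" by (simp_all add: reduce_def foldr_push_reduced)
  then have "foldr push_letter (push_letter x (reduce u)) (reduce w) =
      push_letter x (foldr push_letter (reduce u) (reduce w))"
    by (rule foldr_push_push)
  then show ?case using Cons.IH by (simp add: free_group_def reduce_def)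
qed

lemma reduce_inv_word:
  assumes "w \<in> words m"
  shows "reduce (inv_word w) = inv\<^bsub>free_group {..<m}\<^esub> reduce w"
proof -
  interpret F: group "free_group {..<m}" by (rule group_free_group)
  have "reduce (inv_word w @ w) = []"
    using foldr_push_inverse[of "[]" w] by (simp add: reduce_def inv_word_def)
  then have "reduce (inv_word w) \<otimes>\<^bsub>free_group {..<m}\<^esub> reduce w = \<one>\<^bsub>free_group {..<m}\<^esub>"
    by (simp add: reduce_append[symmetric]) (simp add: free_group_def)
  then show ?thesis using assms by (simp add: F.inv_equality)
qed

lemma endpoint_push_letter: "endpoint (push_letter x w) = letter_vec x + endpoint w"
  by (cases w) auto

lemma endpoint_reduce [simp]: "endpoint (reduce w) = endpoint w"
  unfolding reduce_def by (induction w) (simp_all add: endpoint_push_letter)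

lemma flow_reduce [simp]: "flow B (reduce w) v i = flow B w v i"
proof (induction w arbitrary: v)
  case (Cons x w)
  then show ?case
    using flow_push_letter[of B x "reduce w" v i] flow_Cons[of B x "reduce w" v i]
      flow_Cons[of B x w v i]
    by (simp add: reduce_def)
qed (simp add: reduce_def)

lemma endpoint_mult:
  assumes "u \<in> carrier (free_group {..<m})" "w \<in> carrier (free_group {..<m})"
  shows "endpoint (u \<otimes>\<^bsub>free_group {..<m}\<^esub> w) = endpoint u + endpoint w"
  using endpoint_reduce[of "u @ w"] reduce_append[of u w m] assms by (simp add: reduce_id)

lemma flow_mult:
  assumes "u \<in> carrier (free_group {..<m})" "w \<in> carrier (free_group {..<m})"
  shows "flow B (u \<otimes>\<^bsub>free_group {..<m}\<^esub> w) v i = flow B u v i + flow B w (v - endpoint u) i"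
  using flow_reduce[of B "u @ w"] reduce_append[of u w m] assms by (simp add: reduce_id flow_append)

lemma endpoint_inv:
  assumes "w \<in> carrier (free_group {..<m})"
  shows "endpoint (inv\<^bsub>free_group {..<m}\<^esub> w) = - endpoint w"
proof -
  have "inv\<^bsub>free_group {..<m}\<^esub> w = reduce (inv_word w)"
    using reduce_inv_word[of w m] assms reduce_id[OF assms] by (simp add: carrier_free_group_iff)
  then show ?thesis by (simp)
qed

lemma flow_inv:
  assumes "w \<in> carrier (free_group {..<m})"
  shows "flow B (inv\<^bsub>free_group {..<m}\<^esub> w) v i = - flow B w (v + endpoint w) i"
proof -
  have "inv\<^bsub>free_group {..<m}\<^esub> w = reduce (inv_word w)"
    using reduce_inv_word[of w m] assms reduce_id[OF assms] by (simp add: carrier_free_group_iff)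
  then show ?thesis by (simp add: flow_inv_word)
qed

lemma derived_endpoint:
  assumes "w \<in> derived (free_group {..<m}) (carrier (free_group {..<m}))"
  shows "endpoint w = 0"
proof -
  let ?F = "free_group {..<m}"
  interpret F: group ?F by (rule group_free_group)
  let ?H = "{w \<in> carrier ?F. endpoint w = 0}"
  have "subgroup ?H ?F"
    by (rule F.subgroupI) (auto simp: endpoint_mult endpoint_inv intro!: exI[of _ "\<one>\<^bsub>?F\<^esub>"],
        simp add: free_group_def)
  moreover have "derived_set ?F (carrier ?F) \<subseteq> ?H"
    by (auto simp: endpoint_mult endpoint_inv)
  ultimately have "derived ?F (carrier ?F) \<subseteq> ?H"
    unfolding derived_def by (rule F.generate_subgroup_incl[rotated])
  then show ?thesis using assms by auto
qed

text \<open>On words with endpoint zero the flow is additive, hence it vanishes on their commutators.\<close>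

lemma derived_derived_flow:
  assumes "w \<in> (derived (free_group {..<m}) ^^ 2) (carrier (free_group {..<m}))"
  shows "endpoint w = 0" "flow B w v i = 0"
proof -
  let ?F = "free_group {..<m}"
  interpret F: group ?F by (rule group_free_group)
  let ?H = "{w \<in> carrier ?F. endpoint w = 0 \<and> (\<forall>v. flow B w v i = 0)}"
  let ?D = "derived ?F (carrier ?F)"
  have D: "?D \<subseteq> carrier ?F" by (rule F.derived_in_carrier) simp
  have one: "\<one>\<^bsub>?F\<^esub> \<in> ?H"
    using F.one_closed by (simp add: free_group_def)
  have "subgroup ?H ?F"
    by (rule F.subgroupI) (use one in \<open>auto simp: endpoint_mult endpoint_inv flow_mult flow_inv\<close>)
  moreover have "derived_set ?F ?D \<subseteq> ?H"
    using D derived_endpoint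
    by (auto simp: endpoint_mult endpoint_inv flow_mult flow_inv subset_iff)
  ultimately have "derived ?F ?D \<subseteq> ?H"
    unfolding derived_def by (rule F.generate_subgroup_incl[rotated])
  then have "w \<in> ?H" using assms by (auto simp: numeral_2_eq_2)
  then show "endpoint w = 0" "flow B w v i = 0" by auto
qed

definition list_prod :: "('g, 'b) monoid_scheme \<Rightarrow> ('x \<Rightarrow> 'g) \<Rightarrow> 'x list \<Rightarrow> 'g" where
  "list_prod G f ls = foldr (\<lambda>x y. f x \<otimes>\<^bsub>G\<^esub> y) ls \<one>\<^bsub>G\<^esub>"

lemma list_prod_simps [simp]:
  "list_prod G f [] = \<one>\<^bsub>G\<^esub>" "list_prod G f (x # ls) = f x \<otimes>\<^bsub>G\<^esub> list_prod G f ls"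
  by (simp_all add: list_prod_def)

lemma (in group) list_prod_closed:
  "(\<And>x. x \<in> set ls \<Longrightarrow> f x \<in> carrier G) \<Longrightarrow> list_prod G f ls \<in> carrier G"
  by (induction ls) auto

lemma (in group) list_prod_commuting:
  assumes "f ` set (y # l1 @ l2) \<subseteq> carrier G"
    and "\<And>x. x \<in> set l1 \<Longrightarrow> f x \<otimes> f y = f y \<otimes> f x"
  shows "list_prod G f (l1 @ y # l2) = f y \<otimes> list_prod G f (l1 @ l2)"
  using assms
proof (induction l1)
  case (Cons x l1)
  have c: "f x \<in> carrier G" "f y \<in> carrier G" "list_prod G f (l1 @ l2) \<in> carrier G"
    using Cons.prems(1) by (auto intro!: list_prod_closed)
  have "list_prod G f (l1 @ y # l2) = f y \<otimes> list_prod G f (l1 @ l2)"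
    using Cons.prems by (intro Cons.IH) auto
  then show ?case
    using c Cons.prems(2)[of x] by (simp add: m_assoc[symmetric])
qed simp

text \<open>If commuting elements are attached to the edge classes modulo \<open>B\<close> and reversal inverts them, a product
  of them depends only on the net count of each class.\<close>

lemma (in group) netcount_zero_list_prod:
  assumes B: "vec_subgroup B" and E: "set ls \<subseteq> E" and z: "\<And>v i. netcount B ls v i = 0"
    and closed: "\<And>x. x \<in> E \<Longrightarrow> f x \<in> carrier G"
    and comm: "\<And>x y. x \<in> E \<Longrightarrow> y \<in> E \<Longrightarrow> f x \<otimes> f y = f y \<otimes> f x"
    and cancel: "\<And>x y. x \<in> E \<Longrightarrow> y \<in> E \<Longrightarrow> snd (fst x) = snd (fst y) \<Longrightarrow>
      fst (fst x) - fst (fst y) \<in> B \<Longrightarrow> snd y = (\<not> snd x) \<Longrightarrow> f x \<otimes> f y = \<one>"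
  shows "list_prod G f ls = \<one>"
  using B E z
proof (induction rule: netcount_zero_induct)
  case (pair x l1 y l2)
  have c: "f x \<in> carrier G" "f y \<in> carrier G" "list_prod G f (l1 @ l2) \<in> carrier G"
    using pair closed by (auto intro!: list_prod_closed)
  have "list_prod G f (l1 @ y # l2) = f y \<otimes> list_prod G f (l1 @ l2)"
    using pair closed by (intro list_prod_commuting) (auto intro!: comm)
  then show ?case
    using c pair cancel[of x y] by (simp add: m_assoc[symmetric])
qed simp

text \<open>In the abelianization a word is a product in which each generator occurs with total exponent zero.\<close>

lemma endpoint_zero_derived:
  assumes w: "w \<in> words m" and "endpoint w = 0"
  shows "reduce w \<in> derived (free_group {..<m}) (carrier (free_group {..<m}))"
proof -
  let ?F = "free_group {..<m}"
  let ?D = "derived ?F (carrier ?F)"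
  interpret F: group ?F by (rule group_free_group)
  interpret D: normal ?D ?F by (rule F.derived_is_normal) (rule F.normal_self)
  interpret Q: comm_group "?F Mod ?D" by (rule F.derived_quot_is_comm_group)
  define f :: "signed_edge \<Rightarrow> _" where "f = (\<lambda>((v, i), s). ?D #>\<^bsub>?F\<^esub> reduce [(i, s)])"
  let ?E = "{x. snd (fst x) < m} :: signed_edge set"
  have mult: "(?D #>\<^bsub>?F\<^esub> reduce u) \<otimes>\<^bsub>?F Mod ?D\<^esub> (?D #>\<^bsub>?F\<^esub> reduce u') = ?D #>\<^bsub>?F\<^esub> reduce (u @ u')"
    if "u \<in> words m" "u' \<in> words m" for u u'
    using that by (simp add: D.rcos_sum reduce_append[of u u' m])
  have Nil: "?D #>\<^bsub>?F\<^esub> reduce [] = \<one>\<^bsub>?F Mod ?D\<^esub>"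
    using F.coset_mult_one[of ?D] D.subset by (simp add: reduce_def free_group_def)
  have closed: "f x \<in> carrier (?F Mod ?D)" if "x \<in> ?E" for x
  proof -
    have "reduce [(snd (fst x), snd x)] \<in> carrier ?F" using that by simp
    then show ?thesis by (cases x) (auto simp: f_def carrier_FactGroup split: prod.splits)
  qed
  have prod: "list_prod (?F Mod ?D) f (steps v w) = ?D #>\<^bsub>?F\<^esub> reduce w" for v
    using w
  proof (induction w arbitrary: v)
    case (Cons x w)
    have "f (letter_edge v x) = ?D #>\<^bsub>?F\<^esub> reduce [x]"
      by (cases x) (auto simp: f_def letter_edge_def)
    then show ?case using Cons mult[of "[x]" w] by simp
  qed (simp add: Nil[simplified])
  have "list_prod (?F Mod ?D) f (steps 0 w) = \<one>\<^bsub>?F Mod ?D\<^esub>"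
  proof (rule Q.netcount_zero_list_prod[OF vec_subgroup_UNIV, where E = ?E])
    show "set (steps 0 w) \<subseteq> ?E"
    proof
      fix e assume "e \<in> set (steps 0 w)"
      then show "e \<in> ?E"
        using steps_edges(1)[OF w, of 0 "fst (fst e)" "snd (fst e)" "snd e"] by (cases e) auto
    qed
    show "netcount UNIV (steps 0 w) v i = 0" for v i
      using assms by (simp add: netcount_UNIV_steps)
    show "f x \<otimes>\<^bsub>?F Mod ?D\<^esub> f y = \<one>\<^bsub>?F Mod ?D\<^esub>"
      if xy: "x \<in> ?E" "y \<in> ?E" "snd (fst x) = snd (fst y)" "snd y = (\<not> snd x)" for x y
    proof -
      obtain v i s v' where "x = ((v, i), s)" "y = ((v', i), \<not> s)" "i < m"
        using xy by (cases x; cases y) auto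
      then have "f x \<otimes>\<^bsub>?F Mod ?D\<^esub> f y = ?D #>\<^bsub>?F\<^esub> reduce ([(i, s)] @ [(i, \<not> s)])"
        using mult[of "[(i, s)]" "[(i, \<not> s)]"] by (simp add: f_def)
      also have "reduce ([(i, s)] @ [(i, \<not> s)]) = reduce []"
        by (simp add: reduce_def flip_letter_def)
      finally show ?thesis using Nil by simp
    qed
  qed (use closed Q.m_comm in auto)
  then have "?D #>\<^bsub>?F\<^esub> reduce w = ?D" using prod[of 0] by simp
  then show ?thesis
    using F.coset_join1[of ?D "reduce w"] D.subgroup_axioms D.subset w by simp
qed

lemma normal_derived_derived:
  "(derived (free_group {..<m}) ^^ 2) (carrier (free_group {..<m})) \<lhd> free_group {..<m}"
proof -
  interpret F: group "free_group {..<m}" by (rule group_free_group)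
  show ?thesis
    using F.derived_is_normal[OF F.derived_is_normal[OF F.normal_self]]
    by (simp add: numeral_2_eq_2)
qed

lemma group_free_metabelian: "group (free_metabelian m)"
  unfolding free_metabelian_def by (rule normal.factorgroup_is_group[OF normal_derived_derived])

lemma cls_closed [simp]: "w \<in> words m \<Longrightarrow> cls m w \<in> carrier (free_metabelian m)"
  by (simp add: cls_def free_metabelian_def carrier_FactGroup)

lemma cls_surj: "g \<in> carrier (free_metabelian m) \<Longrightarrow> \<exists>w\<in>words m. g = cls m w"
  by (auto simp: cls_def free_metabelian_def carrier_FactGroup)
    (metis carrier_free_group_iff reduce_id)

lemma cls_append:
  assumes "u \<in> words m" "w \<in> words m"
  shows "cls m (u @ w) = cls m u \<otimes>\<^bsub>free_metabelian m\<^esub> cls m w"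
  using assms by (simp add: cls_def free_metabelian_def normal.rcos_sum[OF normal_derived_derived]
      reduce_append[of u w m])

lemma cls_Nil: "cls m [] = \<one>\<^bsub>free_metabelian m\<^esub>"
proof -
  interpret F: group "free_group {..<m}" by (rule group_free_group)
  show ?thesis
    using F.coset_mult_one[of "(derived (free_group {..<m}) ^^ 2) (carrier (free_group {..<m}))"]
      normal_derived_derived[of m] normal_imp_subgroup subgroup.subset
    by (fastforce simp: cls_def free_metabelian_def reduce_def free_group_def)
qed

lemma cls_inv_word:
  assumes "w \<in> words m"
  shows "cls m (inv_word w) = inv\<^bsub>free_metabelian m\<^esub> cls m w"
  using assms
  by (simp add: cls_def free_metabelian_def normal.inv_FactGroup[OF normal_derived_derived]
      carrier_FactGroup reduce_inv_word normal.rcos_inv[OF normal_derived_derived])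

lemma cls_eq_one_iff:
  assumes "w \<in> words m"
  shows "cls m w = \<one>\<^bsub>free_metabelian m\<^esub> \<longleftrightarrow>
    reduce w \<in> (derived (free_group {..<m}) ^^ 2) (carrier (free_group {..<m}))"
proof -
  interpret F: group "free_group {..<m}" by (rule group_free_group)
  interpret D: normal "(derived (free_group {..<m}) ^^ 2) (carrier (free_group {..<m}))" "free_group {..<m}"
    by (rule normal_derived_derived)
  show ?thesis
    using assms F.coset_join1[of _ "reduce w"] F.coset_join2[of "reduce w"] D.subgroup_axioms D.subset
    by (auto simp: cls_def free_metabelian_def)
qed

text \<open>Flows and endpoints are invariants of the elements of \<open>F/F''\<close>, for every \<open>B\<close>.\<close>

lemma cls_eqD:
  assumes "cls m u = cls m w" "u \<in> words m" "w \<in> words m"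
  shows "endpoint u = endpoint w" "flow B u v i = flow B w v i"
proof -
  interpret G: group "free_metabelian m" by (rule group_free_metabelian)
  have "cls m (u @ inv_word w) = \<one>\<^bsub>free_metabelian m\<^esub>"
    using assms by (simp add: cls_append cls_inv_word)
  then have D: "reduce (u @ inv_word w) \<in> (derived (free_group {..<m}) ^^ 2) (carrier (free_group {..<m}))"
    using cls_eq_one_iff[of "u @ inv_word w" m] assms by simp
  show e: "endpoint u = endpoint w" using derived_derived_flow(1)[OF D] by simp
  show "flow B u v i = flow B w v i"
    using derived_derived_flow(2)[OF D, of B v i] e by (simp add: flow_append flow_inv_word)
qed

lemma cls_commute:
  assumes u: "u \<in> words m" "endpoint u = 0" and w: "w \<in> words m" "endpoint w = 0"
  shows "cls m u \<otimes>\<^bsub>free_metabelian m\<^esub> cls m w = cls m w \<otimes>\<^bsub>free_metabelian m\<^esub> cls m u"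
proof -
  let ?F = "free_group {..<m}"
  interpret G: group "free_metabelian m" by (rule group_free_metabelian)
  have "reduce (u @ w @ inv_word u @ inv_word w) =
      reduce u \<otimes>\<^bsub>?F\<^esub> reduce w \<otimes>\<^bsub>?F\<^esub> inv\<^bsub>?F\<^esub> reduce u \<otimes>\<^bsub>?F\<^esub> inv\<^bsub>?F\<^esub> reduce w"
    using u w reduce_append[of "u @ w @ inv_word u" "inv_word w" m]
      reduce_append[of "u @ w" "inv_word u" m]
    by (simp add: reduce_append[of u w m] reduce_inv_word)
  moreover have "reduce u \<in> derived ?F (carrier ?F)" "reduce w \<in> derived ?F (carrier ?F)"
    using endpoint_zero_derived u w by auto
  ultimately have "reduce (u @ w @ inv_word u @ inv_word w) \<in> derived_set ?F (derived ?F (carrier ?F))"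
    by blast
  then have "reduce (u @ w @ inv_word u @ inv_word w) \<in> (derived ?F ^^ 2) (carrier ?F)"
    by (simp add: numeral_2_eq_2 derived_def generate.incl)
  then have "cls m (u @ w @ inv_word u @ inv_word w) = \<one>\<^bsub>free_metabelian m\<^esub>"
    using u w by (simp add: cls_eq_one_iff)
  then have "cls m u \<otimes>\<^bsub>free_metabelian m\<^esub> cls m w \<otimes>\<^bsub>free_metabelian m\<^esub>
      inv\<^bsub>free_metabelian m\<^esub> (cls m w \<otimes>\<^bsub>free_metabelian m\<^esub> cls m u) = \<one>\<^bsub>free_metabelian m\<^esub>"
    using u w by (simp add: cls_append cls_inv_word G.inv_mult_group G.m_assoc)
  then show ?thesis using u w by (simp add: G.inv_solve_right')
qed

text \<open>Choose a word \<open>p v\<close> from \<open>0\<close> to every lattice point \<open>v\<close>. Inserting the return path and its inverse after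
  each letter of \<open>w\<close> writes \<open>w\<close> as a product of loops \<open>\<gamma> v i\<close> through single edges. The loops commute
  modulo \<open>F''\<close>, so that zero flow makes the product trivial.\<close>

lemma flow_zero_cls:
  assumes w: "w \<in> words m" and e: "endpoint w = 0" and fl: "\<And>v i. flow {0} w v i = 0"
  shows "cls m w = \<one>\<^bsub>free_metabelian m\<^esub>"
proof -
  let ?G = "free_metabelian m"
  interpret G: group ?G by (rule group_free_metabelian)
  let ?V = "{v. \<forall>i\<ge>m. coord v i = 0}"
  have "\<forall>v\<in>?V. \<exists>u. u \<in> words m \<and> endpoint u = v \<and> (v = 0 \<longrightarrow> u = [])"
  proof
    fix v assume "v \<in> ?V"
    then show "\<exists>u. u \<in> words m \<and> endpoint u = v \<and> (v = 0 \<longrightarrow> u = [])"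
      using exists_word_endpoint[of m v] by (cases "v = 0") auto
  qed
  from bchoice[OF this] obtain p where
    p0: "\<forall>v\<in>?V. p v \<in> words m \<and> endpoint (p v) = v \<and> (v = 0 \<longrightarrow> p v = [])" ..
  have p: "\<And>v. v \<in> ?V \<Longrightarrow> p v \<in> words m" "\<And>v. v \<in> ?V \<Longrightarrow> endpoint (p v) = v" "p 0 = []"
    using p0 bspec[OF p0, of 0] by simp_all
  define \<gamma> where "\<gamma> = (\<lambda>v i. p v @ [(i, True)] @ inv_word (p (v + axis i)))"
  define f :: "signed_edge \<Rightarrow> _" where
    "f = (\<lambda>((v, i), s). cls m (if s then \<gamma> v i else inv_word (\<gamma> v i)))"
  let ?E = "{((v, i), s). i < m \<and> v \<in> ?V} :: signed_edge set"
  have \<gamma>: "\<gamma> v i \<in> words m \<and> endpoint (\<gamma> v i) = 0" if "i < m" "v \<in> ?V" for v i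
  proof -
    have "v + axis i \<in> ?V" using that by auto
    then show ?thesis using that p by (simp add: \<gamma>_def letter_vec_def)
  qed
  have closed: "f x \<in> carrier ?G" if "x \<in> ?E" for x
    using that \<gamma> by (auto simp: f_def)
  \<comment> \<open>The inductive form of the insertion of return paths, for paths that start at any point.\<close>
  have telescope: "cls m (p v) \<otimes>\<^bsub>?G\<^esub> cls m w =
      list_prod ?G f (steps v w) \<otimes>\<^bsub>?G\<^esub> cls m (p (v + endpoint w))" if "v \<in> ?V" for v
    using w that
  proof (induction w arbitrary: v)
    case Nil
    then show ?case using p by (simp add: cls_Nil)
  next
    case (Cons x w)
    obtain i s where x: "x = (i, s)" by (cases x)
    have i: "i < m" "w \<in> words m" using Cons.prems x by auto
    let ?v = "v + letter_vec x"
    have v': "?v \<in> ?V" using Cons.prems i by (auto simp: x letter_vec_def)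
    have P: "p v \<in> words m" "p ?v \<in> words m" using p v' Cons.prems by auto
    have split: "cls m ((p v @ [x]) @ inv_word (p ?v)) =
        cls m (p v) \<otimes>\<^bsub>?G\<^esub> cls m [x] \<otimes>\<^bsub>?G\<^esub> inv\<^bsub>?G\<^esub> cls m (p ?v)"
    proof -
      have "[x] \<in> words m" using i x by simp
      then show ?thesis
        using P by (simp only: cls_append cls_inv_word words_simps inv_word_words)
    qed
    have edge: "f (letter_edge v x) = cls m (p v) \<otimes>\<^bsub>?G\<^esub> cls m [x] \<otimes>\<^bsub>?G\<^esub> inv\<^bsub>?G\<^esub> cls m (p ?v)"
    proof (cases s)
      case True
      then have "f (letter_edge v x) = cls m ((p v @ [x]) @ inv_word (p ?v))"
        by (simp add: f_def letter_edge_def x \<gamma>_def letter_vec_def)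
      then show ?thesis using split by (rule trans)
    next
      case False
      have "inv_word (u @ u') = inv_word u' @ inv_word u" "inv_word (inv_word u) = u"
        for u u' :: "(nat \<times> bool) list"
        by (simp_all add: inv_word_def rev_map comp_def)
      then have "f (letter_edge v x) = cls m ((p v @ [x]) @ inv_word (p ?v))"
        using False by (simp add: f_def letter_edge_def x \<gamma>_def letter_vec_def flip_letter_def)
      then show ?thesis using split by (rule trans)
    qed
    have "set (steps ?v w) \<subseteq> ?E"
    proof
      fix e assume "e \<in> set (steps ?v w)"
      then show "e \<in> ?E"
        using steps_edges[OF i(2), of ?v "fst (fst e)" "snd (fst e)" "snd e"] v' by (cases e) auto
    qed
    then have L: "list_prod ?G f (steps ?v w) \<in> carrier ?G"
      using closed by (intro G.list_prod_closed) auto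
    have x1: "cls m [x] \<in> carrier ?G" using i x by simp
    have "?v + endpoint w \<in> ?V" using v' i endpoint_support by auto
    then have p': "p (?v + endpoint w) \<in> words m" using p by blast
    have "list_prod ?G f (steps v (x # w)) \<otimes>\<^bsub>?G\<^esub> cls m (p (v + endpoint (x # w)))
        = f (letter_edge v x) \<otimes>\<^bsub>?G\<^esub> (list_prod ?G f (steps ?v w) \<otimes>\<^bsub>?G\<^esub> cls m (p (?v + endpoint w)))"
    proof -
      have "f (letter_edge v x) \<in> carrier ?G" using P x1 by (simp add: edge)
      then show ?thesis using L p' by (simp add: G.m_assoc add.assoc)
    qed
    also have "\<dots> = f (letter_edge v x) \<otimes>\<^bsub>?G\<^esub> (cls m (p ?v) \<otimes>\<^bsub>?G\<^esub> cls m w)"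
      using Cons.IH[OF i(2) v'] by simp
    also have "\<dots> = cls m (p v) \<otimes>\<^bsub>?G\<^esub> (cls m [x] \<otimes>\<^bsub>?G\<^esub> cls m w)"
    proof -
      have "a \<otimes>\<^bsub>?G\<^esub> b \<otimes>\<^bsub>?G\<^esub> inv\<^bsub>?G\<^esub> c \<otimes>\<^bsub>?G\<^esub> (c \<otimes>\<^bsub>?G\<^esub> d) = a \<otimes>\<^bsub>?G\<^esub> (b \<otimes>\<^bsub>?G\<^esub> d)"
        if "a \<in> carrier ?G" "b \<in> carrier ?G" "c \<in> carrier ?G" "d \<in> carrier ?G" for a b c d
        using that by (simp add: G.m_assoc G.inv_solve_left' G.m_assoc[symmetric, of "inv\<^bsub>?G\<^esub> c" c d])
      then show ?thesis unfolding edge using P i x1 by simp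
    qed
    also have "cls m [x] \<otimes>\<^bsub>?G\<^esub> cls m w = cls m (x # w)"
      using cls_append[of "[x]" m w] i x by simp
    finally show ?case by simp
  qed
  have "list_prod ?G f (steps 0 w) = \<one>\<^bsub>?G\<^esub>"
  proof (rule G.netcount_zero_list_prod[OF vec_subgroup_zero, where E = ?E])
    show "set (steps 0 w) \<subseteq> ?E"
    proof
      fix e assume "e \<in> set (steps 0 w)"
      then show "e \<in> ?E"
        using steps_edges[OF w, of 0 "fst (fst e)" "snd (fst e)" "snd e"] by (cases e) auto
    qed
    show "netcount {0} (steps 0 w) v i = 0" for v i
      using fl by (simp add: flow_def)
    show "f x \<otimes>\<^bsub>?G\<^esub> f y = f y \<otimes>\<^bsub>?G\<^esub> f x" if "x \<in> ?E" "y \<in> ?E" for x y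
    proof -
      have rep: "\<exists>u\<in>words m. endpoint u = 0 \<and> f z = cls m u" if z: "z \<in> ?E" for z
      proof -
        obtain v i s where "z = ((v, i), s)" "i < m" "v \<in> ?V" using z by auto
        then show ?thesis
          using \<gamma>[of i v] by (intro bexI[of _ "if s then \<gamma> v i else inv_word (\<gamma> v i)"])
            (simp_all add: f_def)
      qed
      obtain u u' where "u \<in> words m" "endpoint u = 0" "f x = cls m u"
          "u' \<in> words m" "endpoint u' = 0" "f y = cls m u'"
        using rep[OF \<open>x \<in> ?E\<close>] rep[OF \<open>y \<in> ?E\<close>] by blast
      then show ?thesis by (simp add: cls_commute)
    qed
    show "f x \<otimes>\<^bsub>?G\<^esub> f y = \<one>\<^bsub>?G\<^esub>"
      if xy: "x \<in> ?E" "y \<in> ?E" "snd (fst x) = snd (fst y)" "fst (fst x) - fst (fst y) \<in> {0}"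
        "snd y = (\<not> snd x)" for x y
    proof -
      obtain v i s where "x = ((v, i), s)" "y = ((v, i), \<not> s)" "i < m" "v \<in> ?V"
        using xy by (cases x; cases y) auto
      then show ?thesis using \<gamma>[of i v] by (auto simp: f_def cls_inv_word)
    qed
  qed (use closed in auto)
  then show ?thesis using telescope[of 0] e p(3) w by (simp add: cls_Nil)
qed

lemma flow_eq_cls_eq:
  assumes "u \<in> words m" "w \<in> words m" "endpoint u = endpoint w"
    and "\<And>v i. flow {0} u v i = flow {0} w v i"
  shows "cls m u = cls m w"
proof -
  interpret G: group "free_metabelian m" by (rule group_free_metabelian)
  have "cls m (u @ inv_word w) = \<one>\<^bsub>free_metabelian m\<^esub>"
    using assms by (intro flow_zero_cls) (auto simp: flow_append flow_inv_word)
  then have "cls m u \<otimes>\<^bsub>free_metabelian m\<^esub> inv\<^bsub>free_metabelian m\<^esub> cls m w = \<one>\<^bsub>free_metabelian m\<^esub>"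
    using assms by (simp add: cls_append cls_inv_word)
  then show ?thesis using assms by (simp add: G.inv_solve_right')
qed

section \<open>Realizing flows by words, and conjugacy\<close>

text \<open>Integral 1-chains of the Cayley graph of \<open>\<int>\<^sup>m\<close>.\<close>

definition chain :: "nat \<Rightarrow> (vec \<Rightarrow> nat \<Rightarrow> int) \<Rightarrow> bool" where
  "chain m c \<longleftrightarrow> finite {e. c (fst e) (snd e) \<noteq> 0} \<and>
    (\<forall>v i. c v i \<noteq> 0 \<longrightarrow> i < m \<and> (\<forall>j\<ge>m. coord v j = 0))"

lemma chain_zero: "chain m (\<lambda>v i. 0)"
  by (simp add: chain_def)

lemma chain_add:
  assumes "chain m c" "chain m d"
  shows "chain m (\<lambda>v i. c v i + k * d v i)"
proof -
  have "{e. c (fst e) (snd e) + k * d (fst e) (snd e) \<noteq> 0} \<subseteq>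
      {e. c (fst e) (snd e) \<noteq> 0} \<union> {e. d (fst e) (snd e) \<noteq> 0}" by auto
  then have "finite {e. c (fst e) (snd e) + k * d (fst e) (snd e) \<noteq> 0}"
    by (rule finite_subset) (use assms in \<open>simp add: chain_def\<close>)
  moreover have "i < m \<and> (\<forall>j\<ge>m. coord v j = 0)" if "c v i + k * d v i \<noteq> 0" for v i
  proof -
    have "c v i \<noteq> 0 \<or> d v i \<noteq> 0" using that by auto
    then show ?thesis using assms by (auto simp: chain_def)
  qed
  ultimately show ?thesis by (auto simp: chain_def)
qed

lemma chain_single:
  assumes "j < m" "\<forall>i\<ge>m. coord u i = 0"
  shows "chain m (\<lambda>v i. if v = u \<and> i = j then 1 else 0)"
proof -
  have "{e. (if fst e = u \<and> snd e = j then 1 else 0 :: int) \<noteq> 0} = {(u, j)}"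
    by (auto split: if_splits)
  then show ?thesis using assms by (auto simp: chain_def split: if_splits)
qed

lemma flow_multiple:
  assumes "w \<in> words m" "endpoint w = 0"
  shows "\<exists>z\<in>words m. endpoint z = 0 \<and> (\<forall>v i. flow B z v i = k * flow B w v i)"
proof (induction k rule: int_induct[where k = 0])
  case base
  then show ?case by (intro bexI[of _ "[]"]) auto
next
  case (step1 k)
  then obtain z where "z \<in> words m" "endpoint z = 0" "\<forall>v i. flow B z v i = k * flow B w v i" by blast
  then show ?case using assms
    by (intro bexI[of _ "z @ w"]) (auto simp: flow_append algebra_simps)
next
  case (step2 k)
  then obtain z where "z \<in> words m" "endpoint z = 0" "\<forall>v i. flow B z v i = k * flow B w v i" by blast
  then show ?case using assms
    by (intro bexI[of _ "z @ inv_word w"]) (auto simp: flow_append flow_inv_word algebra_simps)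
qed

lemma flow_combination:
  assumes "finite T" "\<And>e. e \<in> T \<Longrightarrow> \<gamma> e \<in> words m \<and> endpoint (\<gamma> e) = 0"
  shows "\<exists>z\<in>words m. endpoint z = 0 \<and> (\<forall>v i. flow B z v i = (\<Sum>e\<in>T. c e * flow B (\<gamma> e) v i))"
  using assms
proof (induction T rule: finite_induct)
  case empty
  then show ?case by (intro bexI[of _ "[]"]) auto
next
  case (insert e T)
  then obtain z where z: "z \<in> words m" "endpoint z = 0"
    "\<forall>v i. flow B z v i = (\<Sum>e\<in>T. c e * flow B (\<gamma> e) v i)" by auto
  obtain y where y: "y \<in> words m" "endpoint y = 0" "\<forall>v i. flow B y v i = c e * flow B (\<gamma> e) v i"
    using flow_multiple[of "\<gamma> e" m B "c e"] insert.prems by auto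
  show ?case using y z insert by (intro bexI[of _ "y @ z"]) (auto simp: flow_append)
qed

text \<open>Add up, with multiplicities \<open>c\<close>, the loops that run from \<open>0\<close> along \<open>p v\<close>, through one edge, and back.
  At each point the multiplicities of the paths \<open>p v\<close> used forwards and backwards agree because \<open>c\<close> has
  no boundary there, so that only \<open>c\<close> remains of the total flow.\<close>

lemma exists_closed_word:
  assumes c: "chain m c" and bd: "\<And>x. (\<Sum>i<m. c (x - axis i) i - c x i) = 0"
  shows "\<exists>z\<in>words m. endpoint z = 0 \<and> (\<forall>v i. flow {0} z v i = c v i)"
proof -
  let ?V = "{v. \<forall>i\<ge>m. coord v i = 0}"
  have "\<forall>v\<in>?V. \<exists>u. u \<in> words m \<and> endpoint u = v"
    using exists_word_endpoint[of m] by fastforce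
  from bchoice[OF this] obtain p where
    p: "\<forall>v\<in>?V. p v \<in> words m \<and> endpoint (p v) = v" ..
  define \<gamma> where "\<gamma> = (\<lambda>(v, i). p v @ [(i, True)] @ inv_word (p (v + axis i)))"
  let ?c = "\<lambda>e. c (fst e) (snd e)"
  define T where "T = {e. ?c e \<noteq> 0}"
  have finT: "finite T" using c by (simp add: chain_def T_def)
  have T: "i < m" "v \<in> ?V" "v + axis i \<in> ?V" if "(v, i) \<in> T" for v i
  proof -
    show "i < m" "v \<in> ?V" using that c by (auto simp: chain_def T_def)
    then show "v + axis i \<in> ?V" by auto
  qed
  have \<gamma>: "\<gamma> e \<in> words m \<and> endpoint (\<gamma> e) = 0" if "e \<in> T" for e
  proof -
    obtain v i where "e = (v, i)" by (cases e)
    then show ?thesis using that T[of v i] p by (simp add: \<gamma>_def letter_vec_def)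
  qed
  obtain z where z: "z \<in> words m" "endpoint z = 0"
    "\<forall>v i. flow {0} z v i = (\<Sum>e\<in>T. ?c e * flow {0} (\<gamma> e) v i)"
    using flow_combination[OF finT, of \<gamma> m "{0}" ?c] \<gamma> by blast
  have "flow {0} z u j = c u j" for u j
  proof -
    let ?P = "\<lambda>v. flow {0} (p v) u j"
    define W where "W = fst ` T \<union> (\<lambda>(v, i). v + axis i) ` T"
    have finW: "finite W" using finT by (simp add: W_def)
    have flow_\<gamma>: "flow {0} (\<gamma> e) u j =
        (if e = (u, j) then 1 else 0) + (?P (fst e) - ?P (fst e + axis (snd e)))" if "e \<in> T" for e
    proof -
      obtain v i where e: "e = (v, i)" by (cases e)
      have "endpoint (p v) = v" "endpoint (p (v + axis i)) = v + axis i"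
        using p T[of v i] that e by auto
      moreover have "flow {0} [(i, True)] (u - v) j = (if e = (u, j) then 1 else 0)"
        by (auto simp: flow_singleton edge_count_def letter_edge_def e)
      ultimately show ?thesis
        by (simp add: e \<gamma>_def flow_append flow_Cons[of _ _ "inv_word _"] flow_inv_word
            letter_vec_def algebra_simps del: append_Cons)
    qed
    \<comment> \<open>Collect the contributions of the paths by start vertex and by end vertex of the edges.\<close>
    have start: "(\<Sum>e\<in>T. ?c e * ?P (fst e)) = (\<Sum>v\<in>W. \<Sum>i<m. c v i * ?P v)"
    proof -
      have "(\<Sum>e\<in>T. ?c e * ?P (fst e)) = (\<Sum>e\<in>W \<times> {..<m}. ?c e * ?P (fst e))"
      proof (rule sum.mono_neutral_left)
        show "T \<subseteq> W \<times> {..<m}" using T(1) by (force simp: W_def)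
      qed (use finW in \<open>auto simp: T_def\<close>)
      then show ?thesis by (simp add: sum.cartesian_product case_prod_beta)
    qed
    have "end": "(\<Sum>e\<in>T. ?c e * ?P (fst e + axis (snd e))) =
        (\<Sum>v\<in>W. \<Sum>i<m. c (v - axis i) i * ?P v)"
    proof -
      let ?T' = "(\<lambda>(v, i). (v + axis i, i)) ` T"
      have "(\<Sum>e\<in>T. ?c e * ?P (fst e + axis (snd e))) =
          (\<Sum>e\<in>?T'. c (fst e - axis (snd e)) (snd e) * ?P (fst e))"
        by (subst sum.reindex) (auto simp: inj_on_def case_prod_beta)
      also have "\<dots> = (\<Sum>e\<in>W \<times> {..<m}. c (fst e - axis (snd e)) (snd e) * ?P (fst e))"
      proof (rule sum.mono_neutral_left)
        show "?T' \<subseteq> W \<times> {..<m}" using T(1) by (force simp: W_def)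
        have "c (fst e - axis (snd e)) (snd e) = 0" if "e \<notin> ?T'" for e
        proof (rule ccontr)
          assume "c (fst e - axis (snd e)) (snd e) \<noteq> 0"
          then have "(fst e - axis (snd e), snd e) \<in> T" by (simp add: T_def)
          then have "(\<lambda>(v, i). (v + axis i, i)) (fst e - axis (snd e), snd e) \<in> ?T'"
            by (rule imageI)
          then show False using that by simp
        qed
        then show "\<forall>e\<in>W \<times> {..<m} - ?T'. c (fst e - axis (snd e)) (snd e) * ?P (fst e) = 0"
          by auto
      qed (use finW in simp)
      finally show ?thesis by (simp add: sum.cartesian_product case_prod_beta)
    qed
    have "flow {0} z u j = (\<Sum>e\<in>T. (if e = (u, j) then ?c e else 0)) +
        ((\<Sum>e\<in>T. ?c e * ?P (fst e)) - (\<Sum>e\<in>T. ?c e * ?P (fst e + axis (snd e))))"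
      using z(3) by (simp add: flow_\<gamma> sum.distrib[symmetric] sum_subtractf[symmetric] algebra_simps
          cong: sum.cong) (rule sum.cong, auto)
    also have "(\<Sum>e\<in>T. (if e = (u, j) then ?c e else 0)) = c u j"
      using finT by (simp add: T_def)
    also have "(\<Sum>e\<in>T. ?c e * ?P (fst e)) - (\<Sum>e\<in>T. ?c e * ?P (fst e + axis (snd e))) =
        - (\<Sum>v\<in>W. (\<Sum>i<m. c (v - axis i) i - c v i) * ?P v)"
      unfolding start "end"
      by (simp add: sum_subtractf left_diff_distrib sum_distrib_right)
    finally show ?thesis by (simp add: bd)
  qed
  then show ?thesis using z by blast
qed

definition multiples :: "vec \<Rightarrow> vec set" where
  "multiples a = range (\<lambda>k. frag_cmul k a)"

lemma multiples_subgroup: "vec_subgroup (multiples a)"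
  unfolding vec_subgroup_def multiples_def
proof (intro conjI ballI)
  show "0 \<in> range (\<lambda>k. frag_cmul k a)" by (rule range_eqI[of _ _ 0]) simp
next
  fix x y assume "x \<in> range (\<lambda>k. frag_cmul k a)" "y \<in> range (\<lambda>k. frag_cmul k a)"
  then obtain k l where "x = frag_cmul k a" "y = frag_cmul l a" by auto
  then show "x - y \<in> range (\<lambda>k. frag_cmul k a)"
    by (intro range_eqI[of _ _ "k - l"]) (simp add: frag_cmul_diff_distrib)
qed

lemma multiples_self: "a \<in> multiples a"
  unfolding multiples_def by (rule range_eqI[of _ _ 1]) simp

text \<open>A telescoping sum of steps of length \<open>a\<close>: the edge at \<open>u + k a\<close> minus the edge at \<open>u\<close> is divisible by
  \<open>1 - a\<close>, where \<open>a\<close> acts by translation.\<close>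

lemma single_difference_divisible:
  assumes "j < m" "\<forall>i\<ge>m. coord u i = 0" "\<forall>i\<ge>m. coord a i = 0"
  shows "\<exists>c. chain m c \<and> (\<forall>v i. (if v = u + frag_cmul k a \<and> i = j then 1 else 0) -
    (if v = u \<and> i = j then 1 else 0) = c v i - c (v - a) i)"
proof (induction k rule: int_induct[where k = 0])
  case base
  show ?case by (intro exI[of _ "\<lambda>v i. 0"]) (auto simp: chain_zero)
next
  case (step1 k)
  then obtain c where c: "chain m c" "\<And>v i. (if v = u + frag_cmul k a \<and> i = j then 1 else 0) -
    (if v = u \<and> i = j then 1 else 0) = c v i - c (v - a) i" by blast
  have "chain m (\<lambda>v i. if v = u + frag_cmul k a \<and> i = j then 1 else 0)"
    using assms by (intro chain_single) auto
  note ch = chain_add[OF c(1) this, of "-1"]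
  have "v - a = u + frag_cmul k a \<longleftrightarrow> v = u + frag_cmul (k + 1) a" for v
    by (auto simp: frag_cmul_distrib algebra_simps)
  then show ?case
    using c(2) by (intro exI[of _ "\<lambda>v i. c v i + -1 * (if v = u + frag_cmul k a \<and> i = j then 1 else 0)"])
      (use ch in \<open>auto simp: algebra_simps\<close>)
next
  case (step2 k)
  then obtain c where c: "chain m c" "\<And>v i. (if v = u + frag_cmul k a \<and> i = j then 1 else 0) -
    (if v = u \<and> i = j then 1 else 0) = c v i - c (v - a) i" by blast
  have "chain m (\<lambda>v i. if v = u + frag_cmul (k - 1) a \<and> i = j then 1 else 0)"
    using assms by (intro chain_single) auto
  note ch = chain_add[OF c(1) this, of 1]
  have "v - a = u + frag_cmul (k - 1) a \<longleftrightarrow> v = u + frag_cmul k a" for v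
    by (auto simp: frag_cmul_diff_distrib algebra_simps)
  then show ?case
    using c(2) by (intro exI[of _ "\<lambda>v i. c v i + 1 * (if v = u + frag_cmul (k - 1) a \<and> i = j then 1 else 0)"])
      (use ch in \<open>auto simp: algebra_simps\<close>)
qed

text \<open>A chain in the kernel of the projection modulo the multiples of \<open>a\<close> is divisible by \<open>1 - a\<close>.\<close>

lemma netcount_multiples_zero_divisible:
  assumes "\<And>v i. netcount (multiples a) ls v i = 0"
    and "set ls \<subseteq> {e. snd (fst e) < m \<and> (\<forall>i\<ge>m. coord (fst (fst e)) i = 0)}"
    and "\<forall>i\<ge>m. coord a i = 0"
  shows "\<exists>c. chain m c \<and> (\<forall>v i. netcount {0} ls v i = c v i - c (v - a) i)"
  using multiples_subgroup assms(2,1)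
proof (induction rule: netcount_zero_induct)
  case Nil
  show ?case by (intro exI[of _ "\<lambda>v i. 0"]) (auto simp: chain_zero)
next
  case (pair x l1 y l2)
  from pair obtain c where c: "chain m c" "\<And>v i. netcount {0} (l1 @ l2) v i = c v i - c (v - a) i"
    by blast
  obtain k where "fst (fst x) - fst (fst y) = frag_cmul k a"
    using pair by (auto simp: multiples_def)
  then have k: "fst (fst x) = fst (fst y) + frag_cmul k a" by (simp add: algebra_simps)
  obtain d where d: "chain m d" "\<And>v i. (if v = fst (fst x) \<and> i = snd (fst x) then 1 else 0) -
    (if v = fst (fst y) \<and> i = snd (fst y) then 1 else 0) = d v i - d (v - a) i"
    using single_difference_divisible[of "snd (fst x)" m "fst (fst y)" a k] pair assms(3) k by auto
  define s :: int where "s = (if snd x then 1 else -1)"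
  have xy: "edge_count {0} x v i + edge_count {0} y v i = s * (d v i - d (v - a) i)" for v i
    using pair by (auto simp: d(2)[symmetric] edge_count_def s_def)
  have "netcount {0} (x # l1 @ y # l2) v i = (c v i + s * d v i) - (c (v - a) i + s * d (v - a) i)"
    for v i
    using c(2)[of v i] xy[of v i]
    by (simp add: right_diff_distrib)
  then show ?case using chain_add[OF c(1) d(1), of s] by blast
qed

text \<open>The boundary of a chain has finite support, and a finitely supported function invariant under a nonzero
  translation vanishes.\<close>

lemma chain_boundary_periodic_zero:
  assumes c: "chain m c" and "a \<noteq> 0"
    and per: "\<And>x. (\<Sum>i<m. c (x - axis i) i - c x i) = (\<Sum>i<m. c (x - a - axis i) i - c (x - a) i)"
  shows "(\<Sum>i<m. c (x - axis i) i - c x i) = 0"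
proof (rule ccontr)
  let ?d = "\<lambda>x. (\<Sum>i<m. c (x - axis i) i - c x i)"
  let ?T = "{e. c (fst e) (snd e) \<noteq> 0}"
  assume nz: "?d x \<noteq> 0"
  have "?d (x - frag_cmul (int n) a) = ?d x" for n
  proof (induction n)
    case (Suc n)
    have e: "x - frag_cmul (int (Suc n)) a = x - frag_cmul (int n) a - a"
      by (simp add: frag_cmul_distrib algebra_simps del: minus_frag_cmul)
    show ?case
      using trans[OF per[of "x - frag_cmul (int n) a", symmetric] Suc.IH] unfolding e .
  qed simp
  then have "range (\<lambda>n. x - frag_cmul (int n) a) \<subseteq> {y. ?d y \<noteq> 0}" using nz by auto
  also have "\<dots> \<subseteq> fst ` ?T \<union> (\<lambda>e. fst e + axis (snd e)) ` ?T"
  proof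
    fix y assume "y \<in> {y. ?d y \<noteq> 0}"
    then obtain i where "c (y - axis i) i - c y i \<noteq> 0"
      by (metis (mono_tags, lifting) mem_Collect_eq sum.neutral)
    then have "(y, i) \<in> ?T \<or> (y - axis i, i) \<in> ?T" by auto
    then show "y \<in> fst ` ?T \<union> (\<lambda>e. fst e + axis (snd e)) ` ?T"
      by (force simp: image_iff)
  qed
  finally have "finite (range (\<lambda>n. x - frag_cmul (int n) a))"
    by (rule finite_subset) (use c in \<open>simp add: chain_def\<close>)
  moreover have "inj (\<lambda>n. x - frag_cmul (int n) a)"
  proof (rule injI)
    fix n n' assume "x - frag_cmul (int n) a = x - frag_cmul (int n') a"
    then have "frag_cmul (int n) a = frag_cmul (int n') a" by (simp del: minus_frag_cmul)
    moreover obtain i where "coord a i \<noteq> 0" using \<open>a \<noteq> 0\<close> poly_mapping_eqI[of a 0] by auto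
    ultimately show "n = n'"
      by (metis lookup_frag_cmul mult_right_cancel of_nat_eq_iff)
  qed
  ultimately show False using finite_imageD infinite_UNIV_nat by blast
qed

text \<open>The contributions of \<open>c\<close> and of its inverse cancel because they differ by a translation in \<open>B\<close>.\<close>

lemma flow_conj:
  assumes "vec_subgroup B" "endpoint g \<in> B"
  shows "flow B (c @ g @ inv_word c) v i = flow B g (v - endpoint c) i"
  using flow_periodic_diff[OF assms(1), of v "v - endpoint g" c i] assms(2)
  by (simp add: flow_append flow_inv_word algebra_simps)

text \<open>A word \<open>c0\<close> with endpoint \<open>b\<close> brings \<open>g\<close> to a conjugate whose flow agrees with that of \<open>h\<close> modulo the
  multiples of \<open>a\<close>. The difference of the flows is \<open>(1 - a) c\<close> for a chain \<open>c\<close>. If \<open>a \<noteq> 0\<close>, the chain has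
  no boundary because the two words have the same start and end, and conjugation by a closed word with
  flow \<open>c\<close> removes the difference. If \<open>a = 0\<close>, there is no difference.\<close>

lemma flow_translate_conjugate:
  assumes g: "g \<in> words m" and h: "h \<in> words m" and a: "endpoint g = a" "endpoint h = a"
    and b: "\<forall>i\<ge>m. coord b i = 0"
    and eq: "\<And>v i. flow (multiples a) h v i = flow (multiples a) g (v - b) i"
  shows "\<exists>z\<in>words m. cls m h = cls m (z @ g @ inv_word z)"
proof -
  obtain c0 where c0: "c0 \<in> words m" "endpoint c0 = b"
    using exists_word_endpoint[of m b] b by auto
  let ?g = "c0 @ g @ inv_word c0"
  have g': "?g \<in> words m" "endpoint ?g = a" using c0 g a by simp_all
  have aV: "\<forall>i\<ge>m. coord a i = 0" using endpoint_support[OF g] a by simp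
  let ?ls = "steps 0 h @ map flip_letter (steps 0 ?g)"
  have zero: "netcount (multiples a) ?ls v i = 0" for v i
    using eq[of v i] flow_conj[OF multiples_subgroup[of a], of g c0 v i] multiples_self[of a] a c0
    by (simp add: flow_def)
  have edges: "set (steps 0 w) \<subseteq> {e. snd (fst e) < m \<and> (\<forall>i\<ge>m. coord (fst (fst e)) i = 0)}"
    if "w \<in> words m" for w
  proof
    fix e assume "e \<in> set (steps 0 w)"
    then show "e \<in> {e. snd (fst e) < m \<and> (\<forall>i\<ge>m. coord (fst (fst e)) i = 0)}"
      using steps_edges[OF that, of 0 "fst (fst e)" "snd (fst e)" "snd e"] by (cases e) auto
  qed
  have "set ?ls \<subseteq> {e. snd (fst e) < m \<and> (\<forall>i\<ge>m. coord (fst (fst e)) i = 0)}"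
    using edges[OF h] edges[OF g'(1)] by (auto simp: flip_letter_def)
  from netcount_multiples_zero_divisible[OF zero this aV]
  obtain c where c: "chain m c"
    and cd: "\<And>v i. flow {0} h v i - flow {0} ?g v i = c v i - c (v - a) i"
    by (auto simp: flow_def)
  show ?thesis
  proof (cases "a = 0")
    case True
    then have "flow {0} h v i = flow {0} ?g v i" for v i using cd[of v i] by simp
    then have "cls m h = cls m ?g" using g' h a by (intro flow_eq_cls_eq) auto
    then show ?thesis using c0 by blast
  next
    case False
    have per: "(\<Sum>i<m. c (x - axis i) i - c x i) = (\<Sum>i<m. c (x - a - axis i) i - c (x - a) i)" for x
    proof -
      have "(\<Sum>i<m. c (x - axis i) i - c x i) - (\<Sum>i<m. c (x - a - axis i) i - c (x - a) i)
        = (\<Sum>i<m. (c (x - axis i) i - c (x - axis i - a) i) - (c x i - c (x - a) i))"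
        by (simp add: sum_subtractf[symmetric] algebra_simps)
      also have "\<dots> = (\<Sum>i<m. (flow {0} h (x - axis i) i - flow {0} ?g (x - axis i) i)
          - (flow {0} h x i - flow {0} ?g x i))"
        by (simp only: cd)
      also have "\<dots> = (\<Sum>i<m. flow {0} h (x - axis i) i - flow {0} h x i)
          - (\<Sum>i<m. flow {0} ?g (x - axis i) i - flow {0} ?g x i)"
        by (simp only: sum_subtractf[symmetric]) (rule sum.cong, auto)
      also have "\<dots> = 0"
        using flow_boundary[OF h, of x] flow_boundary[OF g'(1), of x] a g'(2) by simp
      finally show ?thesis by simp
    qed
    obtain z where z: "z \<in> words m" "endpoint z = 0" "\<forall>v i. flow {0} z v i = c v i"
      using exists_closed_word[OF c chain_boundary_periodic_zero[OF c False per]] by blast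
    have fl: "flow {0} h v i = flow {0} (z @ ?g @ inv_word z) v i" for v i
      using cd[of v i] z g'(2) by (simp add: flow_append[of _ z] flow_append[of _ ?g] flow_inv_word
          del: append_assoc)
    have "cls m h = cls m (z @ ?g @ inv_word z)"
      using fl g' h a z by (intro flow_eq_cls_eq) auto
    moreover have "z @ ?g @ inv_word z = (z @ c0) @ g @ inv_word (z @ c0)"
      by (simp add: inv_word_def)
    ultimately show ?thesis using z c0 by (metis words_simps(3))
  qed
qed

section \<open>Finite quotients that separate conjugacy classes\<close>

text \<open>A map that is compatible with multiplication plays the role of a homomorphism to a finite group without
  naming that group: its fibres are the cosets of a normal subgroup.\<close>

lemma (in group) congruence_separates_conj:
  assumes cong: "\<And>x x' y y'. x \<in> carrier G \<Longrightarrow> x' \<in> carrier G \<Longrightarrow> y \<in> carrier G \<Longrightarrow> y' \<in> carrier G \<Longrightarrow>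
      \<Phi> x = \<Phi> x' \<Longrightarrow> \<Phi> y = \<Phi> y' \<Longrightarrow> \<Phi> (x \<otimes> y) = \<Phi> (x' \<otimes> y')"
    and fin: "finite (\<Phi> ` carrier G)"
    and g: "g \<in> carrier G" and h: "h \<in> carrier G"
    and sep: "\<And>c. c \<in> carrier G \<Longrightarrow> \<Phi> h \<noteq> \<Phi> (c \<otimes> g \<otimes> inv c)"
  shows "\<exists>N. separates_conj G N g h \<and> card (rcosets N) \<le> card (\<Phi> ` carrier G)"
proof -
  define N where "N = {x \<in> carrier G. \<Phi> x = \<Phi> \<one>}"
  have sub: "subgroup N G"
  proof (rule subgroupI)
    show "N \<noteq> {}" by (auto simp: N_def)
    fix x y assume x: "x \<in> N" and y: "y \<in> N"
    have "\<Phi> (x \<otimes> y) = \<Phi> (\<one> \<otimes> \<one>)"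
      using x y by (intro cong) (simp_all add: N_def)
    then show "x \<otimes> y \<in> N" using x y by (simp add: N_def)
    have "\<Phi> (inv x \<otimes> \<one>) = \<Phi> (inv x \<otimes> x)"
      using x by (intro cong) (simp_all add: N_def)
    then show "inv x \<in> N" using x by (simp add: N_def)
  qed (auto simp: N_def)
  have normal: "N \<lhd> G"
  proof (rule normal_invI[OF sub])
    fix x y assume x: "x \<in> carrier G" and y: "y \<in> N"
    then have "\<Phi> (x \<otimes> y \<otimes> inv x) = \<Phi> (x \<otimes> \<one> \<otimes> inv x)"
      by (intro cong) (auto simp: N_def)
    then show "x \<otimes> y \<otimes> inv x \<in> N" using x y by (auto simp: N_def)
  qed
  have coset: "N #> x = {y \<in> carrier G. \<Phi> y = \<Phi> x}" if x: "x \<in> carrier G" for x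
  proof (intro equalityI subsetI)
    fix y assume "y \<in> N #> x"
    then obtain k where "k \<in> N" "y = k \<otimes> x" by (auto simp: r_coset_def)
    moreover from this have "\<Phi> (k \<otimes> x) = \<Phi> (\<one> \<otimes> x)"
      using x by (intro cong) (simp_all add: N_def)
    ultimately show "y \<in> {y \<in> carrier G. \<Phi> y = \<Phi> x}" using x by (simp add: N_def)
  next
    fix y assume y: "y \<in> {y \<in> carrier G. \<Phi> y = \<Phi> x}"
    then have "\<Phi> (y \<otimes> inv x) = \<Phi> (x \<otimes> inv x)"
      using x by (intro cong) simp_all
    then have "y \<otimes> inv x \<in> N" using x y by (simp add: N_def)
    moreover have "y = (y \<otimes> inv x) \<otimes> x" using x y by (simp add: m_assoc)
    ultimately show "y \<in> N #> x" unfolding r_coset_def by blast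
  qed
  interpret N: normal N G by (rule normal)
  have rc: "rcosets N = (\<lambda>p. {y \<in> carrier G. \<Phi> y = p}) ` (\<Phi> ` carrier G)"
    using coset by (auto simp: RCOSETS_def image_iff)
  have "N #> h \<notin> conj_class (G Mod N) (N #> g)"
  proof
    assume "N #> h \<in> conj_class (G Mod N) (N #> g)"
    then obtain c where c: "c \<in> carrier G"
      "N #> h = (N #> c) <#> (N #> g) <#> inv\<^bsub>G Mod N\<^esub> (N #> c)"
      by (auto simp: conj_class_def carrier_FactGroup)
    moreover have "inv\<^bsub>G Mod N\<^esub> (N #> c) = N #> inv c"
      using c by (subst N.inv_FactGroup) (auto simp: carrier_FactGroup N.rcos_inv)
    ultimately have "N #> h = N #> (c \<otimes> g \<otimes> inv c)"
      using g by (simp add: N.rcos_sum)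
    then have "h \<in> N #> (c \<otimes> g \<otimes> inv c)" using rcos_self[OF h sub] by simp
    then have "\<Phi> h = \<Phi> (c \<otimes> g \<otimes> inv c)" using coset c g by auto
    then show False using sep c by blast
  qed
  moreover have "finite (rcosets N)" unfolding rc using fin by simp
  ultimately have "separates_conj G N g h" using normal by (simp add: separates_conj_def)
  moreover have "card (rcosets N) \<le> card (\<Phi> ` carrier G)"
    unfolding rc using fin by (rule card_image_le)
  ultimately show ?thesis by blast
qed

text \<open>The subgroup \<open>\<int>a + L\<int>\<^sup>m\<close> of \<open>\<int>\<^sup>m\<close>.\<close>

definition thickening :: "nat \<Rightarrow> vec \<Rightarrow> int \<Rightarrow> vec set" where
  "thickening m a L = {v. (\<forall>i\<ge>m. coord v i = 0) \<and> (\<exists>k. \<forall>i<m. L dvd coord v i - k * coord a i)}"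

lemma thickening_subgroup: "vec_subgroup (thickening m a L)"
  unfolding vec_subgroup_def
proof (intro conjI ballI)
  show "0 \<in> thickening m a L" by (auto simp: thickening_def intro: exI[of _ 0])
next
  fix x y assume "x \<in> thickening m a L" "y \<in> thickening m a L"
  then obtain k l where kl: "\<forall>i<m. L dvd coord x i - k * coord a i" "\<forall>i<m. L dvd coord y i - l * coord a i"
    and V: "\<forall>i\<ge>m. coord x i = 0" "\<forall>i\<ge>m. coord y i = 0"
    by (auto simp: thickening_def)
  have "L dvd coord (x - y) i - (k - l) * coord a i" if "i < m" for i
  proof -
    have "coord (x - y) i - (k - l) * coord a i = (coord x i - k * coord a i) - (coord y i - l * coord a i)"
      by (simp add: algebra_simps)
    then show ?thesis using kl that by (metis dvd_diff)
  qed
  then show "x - y \<in> thickening m a L" using V unfolding thickening_def by auto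
qed

lemma multiples_thickening:
  assumes "\<forall>i\<ge>m. coord a i = 0"
  shows "multiples a \<subseteq> thickening m a L"
proof
  fix x assume "x \<in> multiples a"
  then obtain k where "x = frag_cmul k a" by (auto simp: multiples_def)
  then show "x \<in> thickening m a L"
    using assms by (auto simp: thickening_def intro!: exI[of _ k])
qed

text \<open>For \<open>a \<noteq> 0\<close> take \<open>L = \<bar>a\<^sub>j\<bar> (12 n\<^sup>2 + 1)\<close> with \<open>a\<^sub>j \<noteq> 0\<close>. If \<open>x \<equiv> k a\<close> modulo \<open>L\<close>, then the minors
  \<open>x\<^sub>i a\<^sub>j - x\<^sub>j a\<^sub>i\<close> are divisible by \<open>L\<close>, and of absolute value at most \<open>12 n\<^sup>2\<close> for small \<open>x\<close>, so they
  vanish and \<open>x\<close> is a rational multiple of \<open>a\<close>. The factor \<open>a\<^sub>j\<close> of \<open>L\<close> makes it an integral one.\<close>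

lemma thickening_modulus:
  fixes n :: int
  assumes aV: "\<forall>i\<ge>m. coord a i = 0" and an: "\<And>i. \<bar>coord a i\<bar> \<le> n"
  shows "\<exists>L. 2 * n < L \<and> L \<le> (n + 1) * (12 * n\<^sup>2 + 1) \<and>
    (\<forall>x\<in>thickening m a L. (\<forall>i. \<bar>coord x i\<bar> \<le> 6 * n) \<longrightarrow> x \<in> multiples a)"
proof -
  have n0: "0 \<le> n" using an[of 0] by linarith
  show ?thesis
  proof (cases "a = 0")
    case True
    have "6 * n + 1 \<le> (n + 1) * (12 * n\<^sup>2 + 1)"
    proof (cases "n = 0")
      case False
      then have "n * 1 \<le> n * n" using n0 by (intro mult_left_mono) auto
      then have "6 * n + 1 \<le> 1 * (12 * n\<^sup>2 + 1)" using n0 by (simp add: power2_eq_square)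
      moreover have "1 * (12 * n\<^sup>2 + 1) \<le> (n + 1) * (12 * n\<^sup>2 + 1)"
        using n0 by (intro mult_right_mono) auto
      ultimately show ?thesis by linarith
    qed simp
    moreover have "x \<in> multiples a"
      if x: "x \<in> thickening m a (6 * n + 1)" "\<forall>i. \<bar>coord x i\<bar> \<le> 6 * n" for x
    proof -
      have "coord x i = 0" for i
      proof (cases "i < m")
        case True
        then have "6 * n + 1 dvd coord x i" using x(1) \<open>a = 0\<close> by (auto simp: thickening_def)
        moreover have "\<bar>coord x i\<bar> < 6 * n + 1" using spec[OF x(2), of i] by linarith
        ultimately show ?thesis using dvd_imp_le_int[of "coord x i" "6 * n + 1"] n0 by auto
      qed (use x in \<open>auto simp: thickening_def\<close>)
      then have "x = a" using True by (intro poly_mapping_eqI) simp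
      then show ?thesis using multiples_self by simp
    qed
    ultimately show ?thesis using n0 by (intro exI[of _ "6 * n + 1"]) auto
  next
    case False
    then obtain j where j: "coord a j \<noteq> 0" using poly_mapping_eqI[of a 0] by auto
    then have jm: "j < m" using aV not_le by blast
    define M where "M = 12 * n\<^sup>2 + 1"
    define L where "L = \<bar>coord a j\<bar> * M"
    have n1: "1 \<le> n" using an[of j] j by linarith
    then have "n * 1 \<le> n * n" by (intro mult_left_mono) auto
    then have M: "2 * n < M" using n1 by (simp add: M_def power2_eq_square)
    have "1 * M \<le> \<bar>coord a j\<bar> * M" using j M n1 by (intro mult_right_mono) auto
    then have LM: "M \<le> L" by (simp add: L_def)
    have "L \<le> (n + 1) * M" unfolding L_def using an[of j] M n1 by (intro mult_right_mono) auto
    moreover have "x \<in> multiples a"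
      if x: "x \<in> thickening m a L" and xn: "\<forall>i. \<bar>coord x i\<bar> \<le> 6 * n" for x
    proof -
      obtain k where k: "\<And>i. i < m \<Longrightarrow> L dvd coord x i - k * coord a i"
        and xV: "\<forall>i\<ge>m. coord x i = 0"
        using x by (auto simp: thickening_def)
      have par: "coord x i * coord a j = coord x j * coord a i" if "i < m" for i
      proof -
        have "L dvd (coord x i - k * coord a i) * coord a j - (coord x j - k * coord a j) * coord a i"
          by (rule dvd_diff[OF dvd_mult2[OF k[OF that]] dvd_mult2[OF k[OF jm]]])
        also have "(coord x i - k * coord a i) * coord a j - (coord x j - k * coord a j) * coord a i =
            coord x i * coord a j - coord x j * coord a i" by (simp add: algebra_simps)
        finally have d: "L dvd coord x i * coord a j - coord x j * coord a i" .
        have "\<bar>coord x i * coord a j\<bar> \<le> (6 * n) * n" "\<bar>coord x j * coord a i\<bar> \<le> (6 * n) * n"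
          unfolding abs_mult using xn an n0 by (intro mult_mono; simp)+
        then have "\<bar>coord x i * coord a j - coord x j * coord a i\<bar> < L"
          using LM by (simp add: M_def power2_eq_square)
        then show ?thesis using d dvd_imp_le_int[of "coord x i * coord a j - coord x j * coord a i" L]
          LM M n1 by fastforce
      qed
      have "coord a j dvd L" by (simp add: L_def)
      then have "coord a j dvd coord x j - k * coord a j" using k[OF jm] dvd_trans by blast
      then have "coord a j dvd coord x j" by (metis dvd_diffD dvd_triv_right diff_add_cancel dvd_add)
      then obtain t where t: "coord x j = coord a j * t" by (rule dvdE)
      have "coord x i = t * coord a i" for i
      proof (cases "i < m")
        case True
        then show ?thesis using par[OF True] j t by (simp add: algebra_simps)
      qed (use xV aV in auto)
      then have "x = frag_cmul t a" by (intro poly_mapping_eqI) simp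
      then show ?thesis by (auto simp: multiples_def)
    qed
    ultimately show ?thesis using M LM by (intro exI[of _ L]) (auto simp: M_def)
  qed
qed

text \<open>Each flow is supported near the origin, up to translation by \<open>B\<close>.\<close>

lemma flow_nonzero_near:
  assumes "flow B w v i \<noteq> 0" "w \<in> words m" "int (length w) \<le> n"
  obtains u where "v - u \<in> B" "\<forall>j\<ge>m. coord u j = 0" "\<forall>j. \<bar>coord u j\<bar> \<le> n"
proof -
  obtain u s where u: "((u, i), s) \<in> set (steps 0 w)" "v - u \<in> B"
    using assms(1) unfolding flow_def by (rule netcount_nonzeroE)
  show ?thesis
  proof (rule that[OF u(2)])
    show "\<forall>j\<ge>m. coord u j = 0" using steps_edges(2)[OF assms(2) _ u(1)] by simp
    have "\<bar>coord u j\<bar> \<le> n" for j using steps_near[OF u(1), of j] assms(3) by simp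
    then show "\<forall>j. \<bar>coord u j\<bar> \<le> n" ..
  qed
qed

lemma flow_cong_subgroup:
  assumes "\<And>u j s. ((u, j), s) \<in> set (steps 0 w) \<Longrightarrow> v - u \<in> B \<longleftrightarrow> v - u \<in> B'"
  shows "flow B w v i = flow B' w v i"
proof -
  have "edge_count B e v i = edge_count B' e v i" if "e \<in> set (steps 0 w)" for e
    using assms[of "fst (fst e)" "snd (fst e)" "snd e"] that by (auto simp: edge_count_def)
  then show ?thesis unfolding flow_def netcount_def by (intro arg_cong[of _ _ sum_list] map_cong) auto
qed

lemma int_eq_if_cong_small:
  fixes x y n q :: int
  assumes "x mod q = y mod q" "\<bar>x\<bar> \<le> n" "\<bar>y\<bar> \<le> n" "2 * n < q"
  shows "x = y"
proof -
  have "q dvd x - y" using assms(1) by (simp add: mod_eq_dvd_iff)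
  moreover have "\<bar>x - y\<bar> < q" using assms by linarith
  ultimately show ?thesis using dvd_imp_le_int[of "x - y" q] assms(2) by fastforce
qed

lemma int_nonzero_if_cong_small:
  fixes x y n q :: int
  assumes "x mod q = y mod q" "\<bar>x\<bar> \<le> n" "2 * n < q" "x \<noteq> 0"
  shows "y \<noteq> 0"
proof -
  have "0 \<le> n" using assms(2) by linarith
  then show ?thesis using int_eq_if_cong_small[of x q 0 n] assms by auto
qed

text \<open>Within the box of radius \<open>5n\<close> the flows of \<open>g\<close> and \<open>h\<close> modulo \<open>\<int>a + L\<int>\<^sup>m\<close> and modulo \<open>\<int>a\<close> agree, and
  their values are determined by the residues modulo \<open>q\<close>. The given translation vector \<open>b\<close> may be large,
  but it must carry a point near the origin where the flow of \<open>g\<close> is nonzero, if there is one, to such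
  a point for \<open>h\<close>; their difference \<open>b'\<close> has size at most \<open>2n\<close> and induces the same translation. Then all comparisons take
  place inside the box.\<close>

lemma thickening_flow_translate:
  fixes n q :: int
  assumes g: "g \<in> words m" "int (length g) \<le> n" and h: "h \<in> words m" "int (length h) \<le> n"
    and aV: "\<forall>i\<ge>m. coord a i = 0"
    and L: "\<forall>x\<in>thickening m a L. (\<forall>i. \<bar>coord x i\<bar> \<le> 6 * n) \<longrightarrow> x \<in> multiples a"
    and q: "2 * n < q"
    and eq: "\<And>v i. flow (thickening m a L) h v i mod q = flow (thickening m a L) g (v - b) i mod q"
  shows "\<exists>b'. (\<forall>i\<ge>m. coord b' i = 0) \<and>
    (\<forall>v i. flow (multiples a) h v i = flow (multiples a) g (v - b') i)"
proof -
  let ?B = "thickening m a L" and ?M = "multiples a"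
  note B = thickening_subgroup[of m a L] and M = multiples_subgroup[of a]
  have n0: "0 \<le> n" using g(2) by linarith
  have local_eq: "flow ?B w v i = flow ?M w v i"
    if w: "w \<in> words m" "int (length w) \<le> n" and v: "\<And>i. \<bar>coord v i\<bar> \<le> 5 * n" for w v i
  proof (rule flow_cong_subgroup)
    fix u j s assume u: "((u, j), s) \<in> set (steps 0 w)"
    have "\<bar>coord (v - u) i\<bar> \<le> 6 * n" for i
      using steps_near[OF u, of i] v[of i] w(2) by simp
    then show "v - u \<in> ?B \<longleftrightarrow> v - u \<in> ?M"
      using L multiples_thickening[OF aV] by blast
  qed
  have bound: "\<bar>flow B' g v i\<bar> \<le> n" "\<bar>flow B' h v i\<bar> \<le> n" for B' v i
    using flow_bound[of B' g v i] flow_bound[of B' h v i] g h by linarith+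
  show ?thesis
  proof (cases "\<exists>p i. flow ?M g p i \<noteq> 0")
    case True
    then obtain p i where p: "flow ?M g p i \<noteq> 0" by blast
    obtain u where u: "p - u \<in> ?M" "\<forall>j\<ge>m. coord u j = 0" "\<forall>j. \<bar>coord u j\<bar> \<le> n"
      by (rule flow_nonzero_near[OF p g]) (rule that)
    have "flow ?M g u i \<noteq> 0" using p flow_periodic_diff[OF M u(1)] by simp
    moreover have "\<bar>coord u j\<bar> \<le> 5 * n" for j using u(3)[rule_format, of j] n0 by linarith
    ultimately have "flow ?B g u i \<noteq> 0" using local_eq[OF g] by simp
    moreover have "flow ?B g u i mod q = flow ?B h (u + b) i mod q"
      using eq[of "u + b" i] by simp
    ultimately have hb: "flow ?B h (u + b) i \<noteq> 0"
      using int_nonzero_if_cong_small[OF _ bound(1) q] by blast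
    obtain u' where u': "u + b - u' \<in> ?B" "\<forall>j\<ge>m. coord u' j = 0" "\<forall>j. \<bar>coord u' j\<bar> \<le> n"
      by (rule flow_nonzero_near[OF hb h]) (rule that)
    define b' where "b' = u' - u"
    have b'V: "\<forall>j\<ge>m. coord b' j = 0" using u u' by (simp add: b'_def)
    have b'n: "\<bar>coord b' j\<bar> \<le> 2 * n" for j using u(3)[rule_format, of j] u'(3)[rule_format, of j] by (simp add: b'_def)
    have "(v - b') - (v - b) \<in> ?B" for v using u'(1) by (simp add: b'_def algebra_simps)
    then have shift: "flow ?B g (v - b) i = flow ?B g (v - b') i" for v i
      using flow_periodic_diff[OF B, of "v - b'" "v - b"] by simp
    \<comment> \<open>Radius \<open>3n\<close> contains the support of the flow of \<open>h\<close> and of the translate by \<open>b'\<close> of that of \<open>g\<close>,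
      up to multiples of \<open>a\<close>.\<close>
    have near: "flow ?M h v i = flow ?M g (v - b') i" if v: "\<And>j. \<bar>coord v j\<bar> \<le> 3 * n" for v i
    proof -
      have "\<bar>coord v j\<bar> \<le> 5 * n" "\<bar>coord (v - b') j\<bar> \<le> 5 * n" for j
        using v[of j] b'n[of j] n0 by simp_all
      then have "flow ?M h v i = flow ?B h v i" "flow ?M g (v - b') i = flow ?B g (v - b') i"
        using local_eq g h by simp_all
      then show ?thesis
        using int_eq_if_cong_small[OF _ bound(2) bound(1) q] eq[of v i] shift[of v i] by simp
    qed
    have "flow ?M h v i = flow ?M g (v - b') i" for v i
    proof -
      have moved: "flow ?M h v i = flow ?M g (v - b') i" if "v - y \<in> ?M" "\<And>j. \<bar>coord y j\<bar> \<le> 3 * n" for y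
      proof -
        have "(v - b') - (y - b') \<in> ?M" using that(1) by simp
        then have "flow ?M g (v - b') i = flow ?M g (y - b') i" by (rule flow_periodic_diff[OF M])
        then show ?thesis
          using near[OF that(2), of i] flow_periodic_diff[OF M that(1), of h i] by simp
      qed
      show ?thesis
      proof (cases "flow ?M h v i = 0")
        case False
        obtain y where y: "v - y \<in> ?M" "\<forall>j\<ge>m. coord y j = 0" "\<forall>j. \<bar>coord y j\<bar> \<le> n"
          by (rule flow_nonzero_near[OF False h]) (rule that)
        show ?thesis
        proof (rule moved[OF y(1)])
          show "\<bar>coord y j\<bar> \<le> 3 * n" for j using y(3)[rule_format, of j] n0 by linarith
        qed
      next
        case zero: True
        show ?thesis
        proof (cases "flow ?M g (v - b') i = 0")
          case False
          obtain y where y: "v - b' - y \<in> ?M" "\<forall>j\<ge>m. coord y j = 0" "\<forall>j. \<bar>coord y j\<bar> \<le> n"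
            by (rule flow_nonzero_near[OF False g]) (rule that)
          show ?thesis
          proof (rule moved[of "y + b'"])
            show "v - (y + b') \<in> ?M" using y(1) by (simp add: algebra_simps)
            show "\<bar>coord (y + b') j\<bar> \<le> 3 * n" for j using y(3)[rule_format, of j] b'n[of j] by simp
          qed
        qed (use zero in simp)
      qed
    qed
    then show ?thesis using b'V by blast
  next
    case False
    have "flow ?M h v i = 0" for v i
    proof (rule ccontr)
      assume nz: "flow ?M h v i \<noteq> 0"
      obtain y where y: "v - y \<in> ?M" "\<forall>j\<ge>m. coord y j = 0" "\<forall>j. \<bar>coord y j\<bar> \<le> n"
        by (rule flow_nonzero_near[OF nz h]) (rule that)
      have "flow ?M h y i \<noteq> 0" using nz flow_periodic_diff[OF M y(1)] by simp
      moreover have "\<bar>coord y j\<bar> \<le> 5 * n" for j using y(3)[rule_format, of j] n0 by linarith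
      ultimately have "flow ?B h y i \<noteq> 0" using local_eq[OF h] by simp
      then have nzB: "flow ?B g (y - b) i \<noteq> 0"
        using int_nonzero_if_cong_small[OF eq bound(2) q] by blast
      obtain z where z: "y - b - z \<in> ?B" "\<forall>j\<ge>m. coord z j = 0" "\<forall>j. \<bar>coord z j\<bar> \<le> n"
        by (rule flow_nonzero_near[OF nzB g]) (rule that)
      have "\<bar>coord z j\<bar> \<le> 5 * n" for j using z(3)[rule_format, of j] n0 by linarith
      then have "flow ?B g z i = 0" using local_eq[OF g, of z i] False by simp
      then show False using nzB flow_periodic_diff[OF B z(1)] by simp
    qed
    then show ?thesis using False by (intro exI[of _ 0]) auto
  qed
qed

definition box :: "nat \<Rightarrow> int \<Rightarrow> vec set" where
  "box m L = {v. (\<forall>i\<ge>m. coord v i = 0) \<and> (\<forall>i<m. coord v i \<in> {0..<L})}"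

lemma card_box: "finite (box m L)" "card (box m L) \<le> nat L ^ m"
proof -
  let ?r = "\<lambda>v. restrict (coord v) {..<m}"
  have inj: "inj_on ?r (box m L)"
  proof (rule inj_onI)
    fix x y assume xy: "x \<in> box m L" "y \<in> box m L" "?r x = ?r y"
    have "coord x i = coord y i" for i
      using xy(1,2) fun_cong[OF xy(3), of i] by (cases "i < m") (auto simp: box_def)
    then show "x = y" by (rule poly_mapping_eqI)
  qed
  have sub: "?r ` box m L \<subseteq> {..<m} \<rightarrow>\<^sub>E {0..<L}" by (auto simp: box_def)
  have fin: "finite ({..<m} \<rightarrow>\<^sub>E {0..<L})" by (intro finite_PiE) auto
  show "finite (box m L)" using inj sub fin by (meson finite_imageD finite_subset)
  have "card (box m L) \<le> card ({..<m} \<rightarrow>\<^sub>E {0..<L})"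
    by (rule card_inj_on_le[OF inj sub fin])
  then show "card (box m L) \<le> nat L ^ m" by (simp add: card_PiE)
qed

lemma box_representative:
  assumes "\<forall>i\<ge>m. coord v i = 0" "0 < L"
  shows "\<exists>u\<in>box m L. v - u \<in> thickening m a L"
proof -
  define u where "u = (\<Sum>i<m. frag_cmul (coord v i mod L) (axis i))"
  have u: "coord u j = (if j < m then coord v j mod L else 0)" for j
  proof -
    have "coord u j = (\<Sum>i<m. if i = j then coord v i mod L else 0)"
      unfolding u_def lookup_sum by (rule sum.cong) auto
    then show ?thesis by simp
  qed
  have "u \<in> box m L" using assms by (simp add: box_def u)
  moreover have "v - u \<in> thickening m a L"
    using assms by (auto simp: thickening_def u intro!: exI[of _ 0])
  ultimately show ?thesis by blast
qed

text \<open>A finite description of the image of \<open>w\<close> in the quotient \<open>(\<int>/q)[\<int>\<^sup>m/B]\<^sup>m \<rtimes> (\<int>/L)\<^sup>m\<close> of the wreath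
  product, where \<open>B = \<int>a + L\<int>\<^sup>m\<close>; it records the flow on a box that meets every coset of \<open>B\<close>.\<close>

definition signature :: "nat \<Rightarrow> vec \<Rightarrow> int \<Rightarrow> int \<Rightarrow> (nat \<times> bool) list \<Rightarrow> (nat \<Rightarrow> int) \<times> (vec \<times> nat \<Rightarrow> int)" where
  "signature m a L q w =
    (restrict (\<lambda>i. coord (endpoint w) i mod L) {..<m},
     restrict (\<lambda>(v, i). flow (thickening m a L) w v i mod q) (box m L \<times> {..<m}))"

lemma signature_card:
  assumes "0 < L" "0 < q"
  shows "finite (range (signature m a L q))"
    "card (range (signature m a L q)) \<le> nat L ^ m * nat q ^ (m * nat L ^ m)"
proof -
  let ?P = "({..<m} \<rightarrow>\<^sub>E {0..<L}) \<times> ((box m L \<times> {..<m}) \<rightarrow>\<^sub>E {0..<q})"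
  have sub: "range (signature m a L q) \<subseteq> ?P"
    using assms by (auto simp: signature_def)
  have fin: "finite ?P" using card_box(1)[of m L] by (intro finite_cartesian_product finite_PiE) auto
  show "finite (range (signature m a L q))" using sub fin by (rule finite_subset)
  have "card (range (signature m a L q)) \<le> card ?P" by (rule card_mono[OF fin sub])
  also have "\<dots> = nat L ^ m * nat q ^ (card (box m L) * m)"
    using card_box(1)[of m L] by (simp add: card_cartesian_product card_PiE)
  also have "\<dots> \<le> nat L ^ m * nat q ^ (m * nat L ^ m)"
    using assms card_box(2)[of m L] by (intro mult_left_mono power_increasing) auto
  finally show "card (range (signature m a L q)) \<le> nat L ^ m * nat q ^ (m * nat L ^ m)" .
qed

lemma signature_eq_iff:
  assumes L: "0 < L" and u: "u \<in> words m" and w: "w \<in> words m"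
  shows "signature m a L q u = signature m a L q w \<longleftrightarrow>
    (\<forall>i<m. coord (endpoint u) i mod L = coord (endpoint w) i mod L) \<and>
    (\<forall>v i. flow (thickening m a L) u v i mod q = flow (thickening m a L) w v i mod q)"
    (is "?l \<longleftrightarrow> ?e \<and> ?f")
proof
  assume ?l
  then have 1: "restrict (\<lambda>i. coord (endpoint u) i mod L) {..<m} = restrict (\<lambda>i. coord (endpoint w) i mod L) {..<m}"
    and 2: "restrict (\<lambda>(v, i). flow (thickening m a L) u v i mod q) (box m L \<times> {..<m}) =
      restrict (\<lambda>(v, i). flow (thickening m a L) w v i mod q) (box m L \<times> {..<m})"
    by (simp_all add: signature_def)
  have ?e using fun_cong[OF 1] by (metis lessThan_iff restrict_apply')
  moreover have "flow (thickening m a L) u v i mod q = flow (thickening m a L) w v i mod q" for v i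
  proof (cases "i < m \<and> (\<forall>j\<ge>m. coord v j = 0)")
    case True
    then obtain x where x: "x \<in> box m L" "v - x \<in> thickening m a L"
      using box_representative L by blast
    have "flow (thickening m a L) u x i mod q = flow (thickening m a L) w x i mod q"
      using fun_cong[OF 2, of "(x, i)"] x True by simp
    then show ?thesis using flow_periodic_diff[OF thickening_subgroup x(2)] by simp
  next
    case False
    have "flow (thickening m a L) z v i = 0" if z: "z \<in> words m" for z
    proof (rule ccontr)
      assume nz: "flow (thickening m a L) z v i \<noteq> 0"
      then have "i < m" using flow_outside[OF z] by (meson not_le)
      moreover obtain y where "v - y \<in> thickening m a L" "\<forall>j\<ge>m. coord y j = 0"
          "\<forall>j. \<bar>coord y j\<bar> \<le> int (length z)"
        by (rule flow_nonzero_near[OF nz z order_refl]) (rule that)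
      then have "\<forall>j\<ge>m. coord v j = 0" by (auto simp: thickening_def)
      ultimately show False using False by blast
    qed
    then show ?thesis using u w by simp
  qed
  ultimately show "?e \<and> ?f" by blast
next
  assume "?e \<and> ?f"
  then show ?l by (auto simp: signature_def restrict_def fun_eq_iff)
qed

lemma signature_append_cong:
  assumes L: "0 < L" and W: "u \<in> words m" "u' \<in> words m" "w \<in> words m" "w' \<in> words m"
    and eq: "signature m a L q u = signature m a L q u'" "signature m a L q w = signature m a L q w'"
  shows "signature m a L q (u @ w) = signature m a L q (u' @ w')"
proof -
  let ?B = "thickening m a L"
  have e: "coord (endpoint u) i mod L = coord (endpoint u') i mod L"
      "coord (endpoint w) i mod L = coord (endpoint w') i mod L" if "i < m" for i
    using eq signature_eq_iff[OF L] W that by auto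
  have f: "flow ?B u v i mod q = flow ?B u' v i mod q" "flow ?B w v i mod q = flow ?B w' v i mod q" for v i
    using eq signature_eq_iff[OF L] W by auto
  have "endpoint u' - endpoint u \<in> ?B"
    using e(1) W by (auto simp: thickening_def endpoint_support mod_eq_dvd_iff[symmetric] intro!: exI[of _ 0])
  then have "flow ?B w' (v - endpoint u) i = flow ?B w' (v - endpoint u') i" for v i
    by (intro flow_periodic_diff thickening_subgroup) simp
  then have "flow ?B (u @ w) v i mod q = flow ?B (u' @ w') v i mod q" for v i
    using mod_add_cong[OF f(1)[of v i] f(2)[of "v - endpoint u" i]] by (simp add: flow_append)
  moreover have "coord (endpoint (u @ w)) i mod L = coord (endpoint (u' @ w')) i mod L" if "i < m" for i
    using mod_add_cong[OF e(1)[OF that] e(2)[OF that]] by simp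
  ultimately show ?thesis using signature_eq_iff[OF L] W by simp
qed

text \<open>If the images of \<open>g\<close> and \<open>h\<close> were conjugate in the finite quotient, they would have the same endpoint, as
  endpoints are small compared to \<open>L\<close>, and their flows would be translates of each other first modulo
  \<open>B\<close> and \<open>q\<close>, then modulo the multiples of \<open>a\<close>. Hence \<open>g\<close> and \<open>h\<close> would be conjugate.\<close>

lemma free_metabelian_separation:
  assumes g: "g \<in> words m" "length g \<le> n" and h: "h \<in> words m" "length h \<le> n"
    and nc: "cls m h \<notin> conj_class (free_metabelian m) (cls m g)"
  shows "\<exists>L \<le> (n + 1) * (12 * n\<^sup>2 + 1). conj_depth (free_metabelian m) (cls m g) (cls m h) \<le>
    enat (L ^ m * (2 * n + 1) ^ (m * L ^ m))"
proof -
  let ?G = "free_metabelian m"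
  interpret G: group ?G by (rule group_free_metabelian)
  define a where "a = endpoint g"
  have aV: "\<forall>i\<ge>m. coord a i = 0" using endpoint_support[OF g(1)] by (simp add: a_def)
  have an: "\<bar>coord a i\<bar> \<le> int n" for i using endpoint_bound[of g i] g(2) by (simp add: a_def)
  obtain L where L: "2 * int n < L" "L \<le> (int n + 1) * (12 * (int n)\<^sup>2 + 1)"
    "\<forall>x\<in>thickening m a L. (\<forall>i. \<bar>coord x i\<bar> \<le> 6 * int n) \<longrightarrow> x \<in> multiples a"
    using thickening_modulus[OF aV an] by blast
  have L0: "0 < L" using L(1) by linarith
  define q where "q = 2 * int n + 1"
  let ?sig = "signature m a L q"
  define \<Phi> where "\<Phi> k = ?sig (SOME w. w \<in> words m \<and> k = cls m w)" for k
  have \<Phi>: "\<Phi> (cls m w) = ?sig w" if w: "w \<in> words m" for w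
  proof -
    let ?w = "SOME w'. w' \<in> words m \<and> cls m w = cls m w'"
    have w': "?w \<in> words m \<and> cls m w = cls m ?w" by (rule someI[of _ w]) (use w in simp)
    then show ?thesis
      using cls_eqD[of m w ?w] w unfolding \<Phi>_def
      by (subst signature_eq_iff[OF L0]) auto
  qed
  have "\<exists>N. separates_conj ?G N (cls m g) (cls m h) \<and>
      card (rcosets\<^bsub>?G\<^esub> N) \<le> card (\<Phi> ` carrier ?G)"
  proof (rule G.congruence_separates_conj)
    fix x x' y y' assume "x \<in> carrier ?G" "x' \<in> carrier ?G" "y \<in> carrier ?G" "y' \<in> carrier ?G"
      and eq: "\<Phi> x = \<Phi> x'" "\<Phi> y = \<Phi> y'"
    then obtain u u' w w' where W: "u \<in> words m" "u' \<in> words m" "w \<in> words m" "w' \<in> words m"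
      and x: "x = cls m u" "x' = cls m u'" "y = cls m w" "y' = cls m w'"
      using cls_surj by metis
    then show "\<Phi> (x \<otimes>\<^bsub>?G\<^esub> y) = \<Phi> (x' \<otimes>\<^bsub>?G\<^esub> y')"
      using signature_append_cong[OF L0 W] eq by (simp add: cls_append[symmetric] \<Phi>)
  next
    show "finite (\<Phi> ` carrier ?G)"
      by (rule finite_subset[OF _ signature_card(1)[OF L0, of q m a]]) (auto simp: \<Phi>_def q_def)
  next
    show "cls m g \<in> carrier ?G" "cls m h \<in> carrier ?G" using g h by simp_all
  next
    fix c assume "c \<in> carrier ?G"
    then obtain w where w: "w \<in> words m" "c = cls m w" using cls_surj by blast
    show "\<Phi> (cls m h) \<noteq> \<Phi> (c \<otimes>\<^bsub>?G\<^esub> cls m g \<otimes>\<^bsub>?G\<^esub> inv\<^bsub>?G\<^esub> c)"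
    proof
      assume "\<Phi> (cls m h) = \<Phi> (c \<otimes>\<^bsub>?G\<^esub> cls m g \<otimes>\<^bsub>?G\<^esub> inv\<^bsub>?G\<^esub> c)"
      moreover have "c \<otimes>\<^bsub>?G\<^esub> cls m g \<otimes>\<^bsub>?G\<^esub> inv\<^bsub>?G\<^esub> c = cls m (w @ g @ inv_word w)"
        using w g by (simp add: cls_append cls_inv_word G.m_assoc)
      ultimately have sig: "?sig h = ?sig (w @ g @ inv_word w)"
        using \<Phi>[of h] \<Phi>[of "w @ g @ inv_word w"] w g h by simp
      have e: "coord (endpoint h) i mod L = coord a i mod L" if "i < m" for i
        using sig signature_eq_iff[OF L0 h(1), of "w @ g @ inv_word w"] w g that by (simp add: a_def)
      have f: "flow (thickening m a L) h v i mod q = flow (thickening m a L) (w @ g @ inv_word w) v i mod q" for v i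
        using sig signature_eq_iff[OF L0 h(1), of "w @ g @ inv_word w"] w g by simp
      have "coord (endpoint h) i = coord a i" for i
      proof (cases "i < m")
        case True
        have "\<bar>coord (endpoint h) i\<bar> \<le> int n" using endpoint_bound[of h i] h(2) by linarith
        then show ?thesis using int_eq_if_cong_small[OF e[OF True] _ an L(1)] by blast
      qed (use aV endpoint_support[OF h(1)] in auto)
      then have ha: "endpoint h = a" by (rule poly_mapping_eqI)
      have "a \<in> thickening m a L" using multiples_thickening[OF aV] multiples_self by blast
      then have "flow (thickening m a L) (w @ g @ inv_word w) v i =
          flow (thickening m a L) g (v - endpoint w) i" for v i
        by (intro flow_conj thickening_subgroup) (simp add: a_def)
      then have "\<And>v i. flow (thickening m a L) h v i mod q = flow (thickening m a L) g (v - endpoint w) i mod q"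
        using f by simp
      from thickening_flow_translate[OF g(1) _ h(1) _ aV L(3) _ this]
      obtain b where b: "\<forall>i\<ge>m. coord b i = 0"
        "\<And>v i. flow (multiples a) h v i = flow (multiples a) g (v - b) i"
        using g(2) h(2) by (auto simp: q_def)
      obtain z where z: "z \<in> words m" "cls m h = cls m (z @ g @ inv_word z)"
        using flow_translate_conjugate[OF g(1) h(1) _ ha b] by (auto simp: a_def)
      then have "cls m h = cls m z \<otimes>\<^bsub>?G\<^esub> cls m g \<otimes>\<^bsub>?G\<^esub> inv\<^bsub>?G\<^esub> cls m z"
        using g by (simp add: cls_append cls_inv_word G.m_assoc)
      then show False using nc z by (auto simp: conj_class_def)
    qed
  qed
  then obtain N where N: "separates_conj ?G N (cls m g) (cls m h)"
    "card (rcosets\<^bsub>?G\<^esub> N) \<le> card (\<Phi> ` carrier ?G)" by blast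
  note N(2)
  also have "card (\<Phi> ` carrier ?G) \<le> card (range ?sig)"
    by (rule card_mono[OF signature_card(1)[OF L0]]) (auto simp: \<Phi>_def q_def)
  also have "\<dots> \<le> nat L ^ m * nat q ^ (m * nat L ^ m)"
    by (rule signature_card(2)[OF L0]) (simp add: q_def)
  also have "nat q = 2 * n + 1" by (simp add: q_def nat_add_distrib nat_mult_distrib)
  finally have "card (rcosets\<^bsub>?G\<^esub> N) \<le> nat L ^ m * (2 * n + 1) ^ (m * nat L ^ m)" .
  moreover have "conj_depth ?G (cls m g) (cls m h) \<le> enat (card (rcosets\<^bsub>?G\<^esub> N))"
    unfolding conj_depth_def using N(1) by (intro Inf_lower) blast
  ultimately have "conj_depth ?G (cls m g) (cls m h) \<le> enat (nat L ^ m * (2 * n + 1) ^ (m * nat L ^ m))"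
    by (meson enat_ord_simps(1) order_trans)
  moreover have "nat L \<le> (n + 1) * (12 * n\<^sup>2 + 1)"
    using L(2) by (simp add: nat_le_iff algebra_simps)
  ultimately show ?thesis by blast
qed

section \<open>Word lengths and growth\<close>

lemma (in group) generate_word:
  assumes "S \<subseteq> carrier G" "g \<in> generate G S"
  shows "\<exists>ws. set ws \<subseteq> S \<union> m_inv G ` S \<and> g = foldr (\<otimes>\<^bsub>G\<^esub>) ws \<one>\<^bsub>G\<^esub>"
proof -
  have foldr_closed: "foldr (\<otimes>) ws x \<in> carrier G"
    if "set ws \<subseteq> S \<union> m_inv G ` S" "x \<in> carrier G" for ws x
    using that assms(1) by (induction ws) auto
  have foldr_append: "foldr (\<otimes>) (us @ ws) \<one> = foldr (\<otimes>) us \<one> \<otimes> foldr (\<otimes>) ws \<one>"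
    if "set us \<subseteq> S \<union> m_inv G ` S" "set ws \<subseteq> S \<union> m_inv G ` S" for us ws
    using that(1)
  proof (induction us)
    case (Cons s us)
    have "s \<in> carrier G" using Cons.prems assms(1) by auto
    then show ?case
      using Cons foldr_closed[of us \<one>] foldr_closed[OF that(2), of \<one>] by (simp add: m_assoc)
  qed (use foldr_closed[OF that(2)] in simp)
  show ?thesis
    using assms(2)
  proof induction
    case one
    then show ?case by (intro exI[of _ "[]"]) simp
  next
    case (incl h)
    then show ?case using assms(1) by (intro exI[of _ "[h]"]) auto
  next
    case (inv h)
    then show ?case using assms(1) by (intro exI[of _ "[inv h]"]) auto
  next
    case (eng h k)
    then obtain us ws where "set us \<subseteq> S \<union> m_inv G ` S" "h = foldr (\<otimes>) us \<one>"
      "set ws \<subseteq> S \<union> m_inv G ` S" "k = foldr (\<otimes>) ws \<one>" by blast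
    then show ?case using foldr_append by (intro exI[of _ "us @ ws"]) auto
  qed
qed

lemma short_words:
  fixes S :: "(nat \<times> bool) list set set"
  assumes "finite S" and S: "S \<subseteq> carrier (free_metabelian m)"
    and gen: "generate (free_metabelian m) S = carrier (free_metabelian m)"
  shows "\<exists>C\<ge>1. \<forall>g\<in>carrier (free_metabelian m).
    \<exists>w\<in>words m. g = cls m w \<and> length w \<le> C * word_length (free_metabelian m) S g"
proof -
  let ?G = "free_metabelian m"
  interpret G: group ?G by (rule group_free_metabelian)
  have "\<forall>s\<in>S. \<exists>w. w \<in> words m \<and> s = cls m w" using S cls_surj by blast
  from bchoice[OF this] obtain r where r: "\<forall>s\<in>S. r s \<in> words m \<and> s = cls m (r s)" ..
  define C where "C = Suc (\<Sum>s\<in>S. length (r s))"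
  have len: "length (r s) \<le> C" if "s \<in> S" for s
    using member_le_sum[OF that, of "\<lambda>s. length (r s)"] \<open>finite S\<close> by (simp add: C_def)
  have letter: "\<exists>w\<in>words m. s = cls m w \<and> length w \<le> C" if "s \<in> S \<union> m_inv ?G ` S" for s
    using that
  proof
    assume "s \<in> S"
    then show ?thesis using r len by blast
  next
    assume "s \<in> m_inv ?G ` S"
    then obtain t where t: "t \<in> S" "s = inv\<^bsub>?G\<^esub> t" by blast
    then have "s = cls m (inv_word (r t))" using r by (metis cls_inv_word)
    then show ?thesis using r len t by (intro bexI[of _ "inv_word (r t)"]) auto
  qed
  have spell: "\<exists>w\<in>words m. foldr (\<otimes>\<^bsub>?G\<^esub>) ws \<one>\<^bsub>?G\<^esub> = cls m w \<and> length w \<le> C * length ws"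
    if "set ws \<subseteq> S \<union> m_inv ?G ` S" for ws
    using that
  proof (induction ws)
    case Nil
    show ?case by (intro bexI[of _ "[]"]) (auto simp: cls_Nil)
  next
    case (Cons s ws)
    then obtain w where w: "w \<in> words m" "foldr (\<otimes>\<^bsub>?G\<^esub>) ws \<one>\<^bsub>?G\<^esub> = cls m w" "length w \<le> C * length ws"
      by auto
    obtain u where u: "u \<in> words m" "s = cls m u" "length u \<le> C" using letter[of s] Cons.prems by auto
    show ?case using u w by (intro bexI[of _ "u @ w"]) (auto simp: cls_append)
  qed
  have "\<exists>w\<in>words m. g = cls m w \<and> length w \<le> C * word_length ?G S g" if g: "g \<in> carrier ?G" for g
  proof -
    let ?P = "\<lambda>n. \<exists>w. length w = n \<and> set w \<subseteq> S \<union> m_inv ?G ` S \<and> g = foldr (\<otimes>\<^bsub>?G\<^esub>) w \<one>\<^bsub>?G\<^esub>"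
    have "\<exists>n. ?P n" using G.generate_word[OF S, of g] g gen by blast
    then have "?P (word_length ?G S g)" unfolding word_length_def by (rule LeastI_ex)
    then show ?thesis using spell by metis
  qed
  then show ?thesis by (intro exI[of _ C]) (auto simp: C_def)
qed

text \<open>With \<open>k\<close> as given, \<open>L \<le> k\<^sup>3\<close> and \<open>2 C n + 1 \<le> k\<close>, so the left-hand side is at most \<open>k\<close> to the power
  \<open>3 m + m k^(3 m) \<le> k^(3 m + 1)\<close>, and \<open>3 m + 1 \<le> k\<^sup>2\<close> because \<open>k \<ge> 4 m\<close>.\<close>

lemma growth_bound:
  fixes C m n L :: nat
  assumes "1 \<le> C" "1 \<le> m" "1 \<le> n" and L: "L \<le> (C * n + 1) * (12 * (C * n)\<^sup>2 + 1)"
    and k: "k = (26 * C ^ 3 + 4 * m) * n"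
  shows "L ^ m * (2 * (C * n) + 1) ^ (m * L ^ m) \<le> k ^ (k ^ (k ^ 2))"
proof -
  define N where "N = C * n"
  have N: "1 \<le> N" using assms by (simp add: N_def)
  have k4: "4 * m \<le> k" using assms by (simp add: add_mult_distrib le_add2 trans_le_add2)
  have kpos: "1 \<le> k" using k4 \<open>1 \<le> m\<close> by linarith
  have "L \<le> (N + 1) * (12 * N\<^sup>2 + 1)" using L by (simp add: N_def)
  also have "\<dots> \<le> (2 * N) * (13 * N\<^sup>2)" using N by (intro mult_mono) auto
  also have "\<dots> = 26 * C ^ 3 * n ^ 3"
    by (simp add: N_def power2_eq_square power3_eq_cube algebra_simps)
  also have "\<dots> \<le> (26 * C ^ 3 + 4 * m) ^ 3 * n ^ 3"
  proof (rule mult_right_mono)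
    show "26 * C ^ 3 \<le> (26 * C ^ 3 + 4 * m) ^ 3"
      using self_le_power[of "26 * C ^ 3 + 4 * m" 3] \<open>1 \<le> m\<close> by linarith
  qed simp
  finally have L3: "L \<le> k ^ 3" by (simp add: k power_mult_distrib)
  have "C \<le> C ^ 3" using \<open>1 \<le> C\<close> by (simp add: self_le_power)
  then have "3 * C * n \<le> k" unfolding k by (intro mult_right_mono) auto
  then have "3 * N \<le> k" by (simp add: N_def)
  then have q: "2 * N + 1 \<le> k" using N by linarith
  have Lm: "L ^ m \<le> k ^ (3 * m)" using power_mono[OF L3, of m] by (simp add: power_mult)
  have "L ^ m * (2 * N + 1) ^ (m * L ^ m) \<le> k ^ (3 * m) * k ^ (m * k ^ (3 * m))"
  proof (rule mult_mono[OF Lm])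
    have "(2 * N + 1) ^ (m * L ^ m) \<le> k ^ (m * L ^ m)" using q by (rule power_mono) simp
    also have "\<dots> \<le> k ^ (m * k ^ (3 * m))" using Lm kpos by (intro power_increasing) auto
    finally show "(2 * N + 1) ^ (m * L ^ m) \<le> k ^ (m * k ^ (3 * m))" .
  qed auto
  also have "\<dots> = k ^ (3 * m + m * k ^ (3 * m))" by (simp add: power_add)
  also have "\<dots> \<le> k ^ (k ^ (k ^ 2))"
  proof (rule power_increasing[OF _ kpos])
    have "3 * m * 1 \<le> 3 * m * k ^ (3 * m)" using kpos by (intro mult_left_mono) auto
    then have "3 * m + m * k ^ (3 * m) \<le> 4 * m * k ^ (3 * m)" by simp
    also have "\<dots> \<le> k * k ^ (3 * m)" using k4 by (rule mult_right_mono) simp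
    also have "\<dots> = k ^ (3 * m + 1)" by simp
    also have "\<dots> \<le> k ^ (k ^ 2)"
    proof (rule power_increasing[OF _ kpos])
      have "k * 1 \<le> k * k" using kpos by (intro mult_left_mono) auto
      then have "k \<le> k ^ 2" by (simp add: power2_eq_square)
      then show "3 * m + 1 \<le> k ^ 2" using k4 \<open>1 \<le> m\<close> by linarith
    qed
    finally show "3 * m + m * k ^ (3 * m) \<le> k ^ k ^ 2" .
  qed
  finally show ?thesis by (simp add: N_def)
qed

theorem theorem4:
  fixes m :: nat and S :: "(nat \<times> bool) list set set"
  assumes "m \<ge> 1"
    and "finite S" and "S \<subseteq> carrier (free_metabelian m)"
    and "generate (free_metabelian m) S = carrier (free_metabelian m)"
  shows "Conj (free_metabelian m) S \<preceq> (\<lambda>n. enat (n ^ (n ^ (n ^ 2))))"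
proof -
  let ?G = "free_metabelian m"
  interpret G: group ?G by (rule group_free_metabelian)
  obtain C where C: "C \<ge> 1" "\<And>g. g \<in> carrier ?G \<Longrightarrow>
      \<exists>w\<in>words m. g = cls m w \<and> length w \<le> C * word_length ?G S g"
    using short_words[OF assms(2-4)] by blast
  define K where "K = 26 * C ^ 3 + 4 * m"
  have K1: "1 \<le> K" using \<open>m \<ge> 1\<close> by (simp add: K_def)
  have "Conj ?G S n \<le> enat K * enat ((K * n) ^ ((K * n) ^ ((K * n) ^ 2)))" for n
    unfolding Conj_def
  proof (rule Sup_least, clarify)
    fix g h
    assume gh: "g \<in> carrier ?G" "h \<in> carrier ?G" and nc: "h \<notin> conj_class ?G g"
      and wl: "word_length ?G S g \<le> n" "word_length ?G S h \<le> n"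
    have short: "\<exists>w\<in>words m. x = cls m w \<and> length w \<le> C * n"
      if x: "x \<in> carrier ?G" "word_length ?G S x \<le> n" for x
    proof -
      obtain w where "w \<in> words m" "x = cls m w" "length w \<le> C * word_length ?G S x"
        using C(2) x(1) by blast
      moreover have "C * word_length ?G S x \<le> C * n" using x(2) by simp
      ultimately show ?thesis using order_trans by blast
    qed
    obtain u where u: "u \<in> words m" "g = cls m u" "length u \<le> C * n"
      using short gh wl by blast
    obtain w where w: "w \<in> words m" "h = cls m w" "length w \<le> C * n"
      using short gh wl by blast
    \<comment> \<open>The claimed bound is \<open>0\<close> at \<open>n = 0\<close>, so there must be no pair to separate.\<close>
    have "n \<noteq> 0"
    proof
      assume "n = 0"
      then have "g = \<one>\<^bsub>?G\<^esub>" "h = \<one>\<^bsub>?G\<^esub>" using u w by (simp_all add: cls_Nil)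
      then have "h = \<one>\<^bsub>?G\<^esub> \<otimes>\<^bsub>?G\<^esub> g \<otimes>\<^bsub>?G\<^esub> inv\<^bsub>?G\<^esub> \<one>\<^bsub>?G\<^esub>" by simp
      then show False using nc G.one_closed unfolding conj_class_def by blast
    qed
    then have n: "1 \<le> n" by simp
    obtain L where "L \<le> (C * n + 1) * (12 * (C * n)\<^sup>2 + 1)"
      and d: "conj_depth ?G g h \<le> enat (L ^ m * (2 * (C * n) + 1) ^ (m * L ^ m))"
      using free_metabelian_separation[OF u(1,3) w(1,3)] nc u w by blast
    then have "L ^ m * (2 * (C * n) + 1) ^ (m * L ^ m) \<le> (K * n) ^ ((K * n) ^ ((K * n) ^ 2))"
      using growth_bound[OF C(1) \<open>m \<ge> 1\<close> n _ refl] by (simp add: K_def)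
    also have "\<dots> \<le> K * (K * n) ^ ((K * n) ^ ((K * n) ^ 2))" using K1 by simp
    finally show "conj_depth ?G g h \<le> enat K * enat ((K * n) ^ ((K * n) ^ ((K * n) ^ 2)))"
      using d by (simp add: order_trans[OF d])
  qed
  then show ?thesis unfolding growth_le_def by blast
qed

end
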